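(* Let $G$ be a graph on $n$ vertices. If $\lambda(G)\ge \sqrt{\lfloor\frac{n^2}{4}\rfloor}$, then $$t(G)\ge \left\lfloor\frac{n}{2}\right\rfloor-1,$$ unless $G$ is the bipartite Turán graph $T_{n,2}$.
   Context: All graphs are finite, simple and undirected. For a graph $G$, $\lambda(G)$ denotes the spectral radius of $G$, i.e. the maximum of the moduli of the eigenvalues of the adjacency matrix $A(G)$, and $t(G)$ denotes the number of triangles (copies of $K_3$) in $G$. The bipartite Turán graph is $T_{n,2}\cong K_{\lfloor n/2\rfloor,\lceil n/2\rceil}$, the complete bipartite graph on $n$ vertices with parts of sizes $\lfloor n/2\rfloor$ and $\lceil n/2\rceil$; "$G$ is $T_{n,2}$" means $G$ is isomorphic to $T_{n,2}$. *)

theory Defs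
  imports
    "Graph_Theory.Graph_Theory"
    "Jordan_Normal_Form.Spectral_Radius"
begin

text \<open>
  A finite simple undirected graph is a \<^locale>\<open>pair_graph\<close>: a finite loop-free digraph whose arcs
  form a symmetric relation, the edge \<open>{u, v}\<close> being represented by the two arcs
  \<open>(u, v)\<close> and \<open>(v, u)\<close>.
\<close>

definition adjacency_matrix :: "'a pair_pre_digraph \<Rightarrow> 'a list \<Rightarrow> complex mat" where
  "adjacency_matrix G vs =
     mat (length vs) (length vs) (\<lambda>(i, j). if (vs ! i, vs ! j) \<in> parcs G then 1 else 0)"

text \<open>
  The chosen enumeration of the vertices is irrelevant, see \<open>graph_spectral_radius_eq\<close> below.
  On the null graph the value is unspecified, the spectrum being empty.
\<close>

definition graph_spectral_radius :: "'a pair_pre_digraph \<Rightarrow> real" where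
  "graph_spectral_radius G =
     spectral_radius (adjacency_matrix G (SOME vs. distinct vs \<and> set vs = pverts G))"

definition triangles :: "'a pair_pre_digraph \<Rightarrow> 'a set set" where
  "triangles G =
     {T. T \<subseteq> pverts G \<and> card T = 3 \<and> (\<forall>u\<in>T. \<forall>v\<in>T. u \<noteq> v \<longrightarrow> (u, v) \<in> parcs G)}"

definition triangle_count :: "'a pair_pre_digraph \<Rightarrow> nat" where
  "triangle_count G = card (triangles G)"

definition complete_bipartite_graph :: "nat \<Rightarrow> nat \<Rightarrow> nat pair_pre_digraph" where
  "complete_bipartite_graph a b =
     \<lparr> pverts = {..<a + b},
       parcs = {..<a} \<times> {a..<a + b} \<union> {a..<a + b} \<times> {..<a} \<rparr>"

definition bipartite_turan_graph :: "nat \<Rightarrow> nat pair_pre_digraph" where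
  "bipartite_turan_graph n =
     complete_bipartite_graph (nat \<lfloor>real n / 2\<rfloor>) (nat \<lceil>real n / 2\<rceil>)"

definition graph_isomorphic :: "'a pair_pre_digraph \<Rightarrow> 'b pair_pre_digraph \<Rightarrow> bool" where
  "graph_isomorphic G H \<longleftrightarrow> digraph_iso (with_proj G) (with_proj H)"

lemma graph_isomorphic_iff:
  assumes "pair_wf_digraph G"
  shows "graph_isomorphic G H \<longleftrightarrow>
    (\<exists>f. bij_betw f (pverts G) (pverts H) \<and> parcs H = map_prod f f ` parcs G)" (is "_ \<longleftrightarrow> ?R")
proof
  interpret pair_wf_digraph G by fact
  assume "graph_isomorphic G H"
  then obtain h where h: "pre_digraph.digraph_isomorphism (with_proj G) h"
    and H: "with_proj H = app_iso h (with_proj G)"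
    by (auto simp: graph_isomorphic_def digraph_iso_def)
  have fields: "pverts H = iso_verts h ` pverts G" "parcs H = iso_arcs h ` parcs G"
    "fst = iso_tail h" "snd = iso_head h"
    using H by (simp_all add: with_proj_def app_iso_def)
  have inj: "inj_on (iso_verts h) (pverts G)"
    and tails: "\<And>e. e \<in> parcs G \<Longrightarrow> iso_verts h (fst e) = fst (iso_arcs h e)"
    and heads: "\<And>e. e \<in> parcs G \<Longrightarrow> iso_verts h (snd e) = snd (iso_arcs h e)"
    using h fields(3,4)[symmetric] by (simp_all add: pre_digraph.digraph_isomorphism_def)
  have "iso_arcs h e = map_prod (iso_verts h) (iso_verts h) e" if "e \<in> parcs G" for e
    using tails[OF that] heads[OF that] by (simp add: prod_eq_iff)
  then have "parcs H = map_prod (iso_verts h) (iso_verts h) ` parcs G"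
    using fields(2) by (simp cong: image_cong)
  with inj fields(1) show ?R
    by (auto simp: bij_betw_def)
next
  interpret pair_wf_digraph G by fact
  assume ?R
  then obtain f where f: "inj_on f (pverts G)" "pverts H = f ` pverts G"
    "parcs H = map_prod f f ` parcs G"
    by (auto simp: bij_betw_def)
  define h where "h = \<lparr> iso_verts = f, iso_arcs = map_prod f f, iso_head = snd, iso_tail = fst \<rparr>"
  have "inj_on (map_prod f f) (parcs G)"
    by (rule inj_on_subset[OF map_prod_inj_on[OF f(1) f(1)]]) (auto dest: in_arcsD1 in_arcsD2)
  then have "pre_digraph.digraph_isomorphism (with_proj G) h"
    using f(1) wf_digraph by (auto simp: pre_digraph.digraph_isomorphism_def h_def)
  moreover have "with_proj H = app_iso h (with_proj G)"
    using f by (simp add: with_proj_def app_iso_def h_def)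
  ultimately show "graph_isomorphic G H"
    by (auto simp: graph_isomorphic_def digraph_iso_def)
qed

lemma eigenvalue_adjacency_matrix_iff:
  assumes "distinct vs" "set vs = pverts G"
  shows "eigenvalue (adjacency_matrix G vs) k \<longleftrightarrow>
    (\<exists>f. (\<exists>u\<in>pverts G. f u \<noteq> 0) \<and>
         (\<forall>u\<in>pverts G. (\<Sum>v\<in>pverts G. if (u, v) \<in> parcs G then f v else 0) = k * f u))"
    (is "_ \<longleftrightarrow> ?R")
proof -
  let ?n = "length vs" and ?A = "adjacency_matrix G vs"
  have bij: "bij_betw ((!) vs) {0..<?n} (pverts G)"
    using assms by (simp add: bij_betw_nth atLeast0LessThan)
  have mult: "(?A *\<^sub>v vec ?n (\<lambda>i. f (vs ! i))) $ i =
      (\<Sum>v\<in>pverts G. if (vs ! i, v) \<in> parcs G then f v else 0)" if "i < ?n" for f i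
  proof -
    have "(?A *\<^sub>v vec ?n (\<lambda>i. f (vs ! i))) $ i =
        (\<Sum>j\<in>{0..<?n}. if (vs ! i, vs ! j) \<in> parcs G then f (vs ! j) else 0)"
      using that by (auto simp: adjacency_matrix_def scalar_prod_def intro!: sum.cong)
    also have "\<dots> = (\<Sum>v\<in>pverts G. if (vs ! i, v) \<in> parcs G then f v else 0)"
      by (rule sum.reindex_bij_betw[OF bij])
    finally show ?thesis .
  qed
  have dims: "dim_row ?A = ?n" "dim_col ?A = ?n"
    by (simp_all add: adjacency_matrix_def)
  have vec_iff: "eigenvector ?A (vec ?n (\<lambda>i. f (vs ! i))) k \<longleftrightarrow>
      (\<exists>u\<in>pverts G. f u \<noteq> 0) \<and>
      (\<forall>u\<in>pverts G. (\<Sum>v\<in>pverts G. if (u, v) \<in> parcs G then f v else 0) = k * f u)" for f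
  proof -
    let ?x = "vec ?n (\<lambda>i. f (vs ! i))"
    have ball: "(\<forall>u\<in>pverts G. P u) \<longleftrightarrow> (\<forall>i<?n. P (vs ! i))" for P
      by (metis assms(2) in_set_conv_nth)
    have "?x \<noteq> 0\<^sub>v ?n \<longleftrightarrow> (\<exists>i<?n. f (vs ! i) \<noteq> 0)"
      by (auto simp: vec_eq_iff)
    also have "\<dots> \<longleftrightarrow> (\<exists>u\<in>pverts G. f u \<noteq> 0)"
      using ball[of "\<lambda>u. f u = 0"] by blast
    finally have nonzero: "?x \<noteq> 0\<^sub>v ?n \<longleftrightarrow> (\<exists>u\<in>pverts G. f u \<noteq> 0)" .
    have "?A *\<^sub>v ?x = k \<cdot>\<^sub>v ?x \<longleftrightarrow> (\<forall>i<?n. (?A *\<^sub>v ?x) $ i = k * f (vs ! i))"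
      by (simp add: vec_eq_iff dims del: index_mult_mat_vec)
    also have "\<dots> \<longleftrightarrow>
        (\<forall>i<?n. (\<Sum>v\<in>pverts G. if (vs ! i, v) \<in> parcs G then f v else 0) = k * f (vs ! i))"
      using mult by (simp del: index_mult_mat_vec)
    finally show ?thesis
      by (simp only: eigenvector_def dims nonzero ball vec_carrier simp_thms)
  qed
  show ?thesis
  proof
    assume "eigenvalue ?A k"
    then obtain x where x: "eigenvector ?A x k"
      by (auto simp: eigenvalue_def)
    define f where "f v = x $ the_inv_into {0..<?n} ((!) vs) v" for v
    have "x = vec ?n (\<lambda>i. f (vs ! i))"
      using x bij by (auto simp: eigenvector_def dims f_def bij_betw_def the_inv_into_f_f)
    with x have "eigenvector ?A (vec ?n (\<lambda>i. f (vs ! i))) k"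
      by simp
    then show ?R
      by (intro exI[of _ f] iffD1[OF vec_iff])
  next
    assume ?R
    then obtain f where "(\<exists>u\<in>pverts G. f u \<noteq> 0) \<and>
        (\<forall>u\<in>pverts G. (\<Sum>v\<in>pverts G. if (u, v) \<in> parcs G then f v else 0) = k * f u)"
      by (elim exE)
    then have "eigenvector ?A (vec ?n (\<lambda>i. f (vs ! i))) k"
      by (rule iffD2[OF vec_iff])
    then show "eigenvalue ?A k"
      unfolding eigenvalue_def by (rule exI)
  qed
qed

lemma graph_spectral_radius_eq:
  assumes "distinct vs" "set vs = pverts G"
  shows "graph_spectral_radius G = spectral_radius (adjacency_matrix G vs)"
proof -
  define ws where "ws = (SOME vs. distinct vs \<and> set vs = pverts G)"
  have "distinct ws \<and> set ws = pverts G"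
    unfolding ws_def by (rule someI[of _ vs]) (rule conjI[OF assms])
  then have ws: "distinct ws" "set ws = pverts G"
    by simp_all
  have "eigenvalue (adjacency_matrix G ws) = eigenvalue (adjacency_matrix G vs)"
    by (rule ext, rule trans[OF eigenvalue_adjacency_matrix_iff[OF ws]
          eigenvalue_adjacency_matrix_iff[OF assms, symmetric]])
  then show ?thesis
    by (simp only: graph_spectral_radius_def ws_def[symmetric] spectral_radius_def spectrum_def)
qed

end

theory Submission
  imports Defs "HOL-Analysis.Convex"
begin

text \<open>
  Write \<open>f = n div 2\<close>, \<open>q = n * n div 4\<close>, and let \<open>m\<close> and \<open>t\<close> be the numbers of edges and of
  triangles, so that the hypothesis is \<open>\<lambda>\<^sup>2 \<ge> q\<close> and the claim is \<open>t \<ge> f - 1\<close>. The argument plays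
  a spectral lower bound on \<open>t\<close>, which is good when there are few edges, against a combinatorial one,
  which is good when there are many.

  The spectral bound (\<open>spectral_triangle_inequality\<close>) is \<open>6 t \<ge> \<rho>\<^sup>3 - (2 m - \<rho>\<^sup>2)\<^sup>3\<^sup>/\<^sup>2\<close> for some
  \<open>\<rho> \<ge> \<lambda>\<close>. In terms of eigenvalues it says that \<open>6 t\<close> is the sum of their cubes, \<open>2 m\<close> is the sum of
  their squares, and the cubes of all but the largest one add up to at least minus the \<open>3/2\<close>-th power
  of the sum of their squares. If \<open>m \<le> q - 2\<close> this already gives \<open>t \<ge> f - 1\<close>; if \<open>m = q - 1\<close> it
  still gives \<open>t \<ge> 1\<close>.

  The combinatorial bound (\<open>arcs_le_triangle_count\<close>) says that a graph with at least one triangle has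
  \<open>m \<le> (n - 1)\<^sup>2 div 4 + t + 1\<close>, equivalently \<open>t \<ge> f - 1 + (m - q)\<close>. Deleting an edge
  that lies in some but not all triangles reduces it to graphs with exactly one triangle; there, every
  vertex outside the triangle sends at most one edge to it and Mantel's theorem bounds the rest. This
  settles \<open>m \<ge> q\<close>, except for triangle-free graphs, where Mantel's theorem with its case of equality
  leaves only the Turan graph.

  What remains is \<open>m = q - 1\<close> and \<open>t = f - 2\<close>, which is exactly the case of equality in the
  combinatorial bound. The extremal graphs (\<open>near_extremal_structure\<close>) are a nearly balanced complete
  bipartite graph with one additional edge \<open>x y\<close> inside a side and one or two edges at \<open>x\<close> or \<open>y\<close>
  missing. For them an explicit positive vector \<open>v\<close> with \<open>A v < \<lambda> v\<close> in every coordinate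
  contradicts the nonnegative vector \<open>g\<close> of moduli of an eigenvector, which satisfies
  \<open>A g \<ge> \<lambda> g\<close> (\<open>no_subinvariant_of_test_vector\<close>). The vector \<open>g\<close> is all that is ever used of the
  spectral radius.
\<close>

section \<open>Quarter squares\<close>

lemma mult_le_quarter_square:
  fixes a b :: nat
  shows "a * b \<le> (a + b) * (a + b) div 4"
proof -
  have "int (4 * (a * b)) \<le> int ((a + b) * (a + b))"
    using zero_le_square[of "int a - int b"] by (simp add: algebra_simps)
  then have "4 * (a * b) \<le> (a + b) * (a + b)" by linarith
  then show ?thesis by linarith
qed

lemma balanced_parts:
  fixes a b :: nat
  assumes "a * b = (a + b) * (a + b) div 4"
  shows "a = (a + b) div 2 \<or> b = (a + b) div 2"
proof -
  have "(a + b) * (a + b) < 4 * (a * b) + 4" using assms by linarith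
  then have "int ((a + b) * (a + b)) < int (4 * (a * b) + 4)" by (rule iffD2[OF of_nat_less_iff])
  then have "(int a - int b)\<^sup>2 < 2\<^sup>2" by (simp add: power2_eq_square algebra_simps)
  then have "\<bar>int a - int b\<bar> < 2" by (metis abs_le_square_iff abs_numeral linorder_not_le)
  then show ?thesis by linarith
qed

lemma quarter_square_cases:
  fixes n :: nat
  defines "f \<equiv> n div 2"
  shows "(n = 2 * f \<and> n * n div 4 = f * f) \<or> (n = 2 * f + 1 \<and> n * n div 4 = f * f + f)"
proof (cases "even n")
  case True
  then have "n = 2 * f" by (simp add: f_def)
  then show ?thesis by (simp add: mult.assoc mult.left_commute)
next
  case False
  then have n: "n = 2 * f + 1" unfolding f_def by simp
  have "n * n = 4 * (f * f + f) + 1" by (simp add: n algebra_simps)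
  then show ?thesis using n by simp
qed

lemma quarter_square_pred:
  fixes n :: nat
  shows "(n - 1) * (n - 1) div 4 + n div 2 = n * n div 4"
proof (cases "n = 0")
  case False
  define f where "f = n div 2"
  have "(n = 2 * f \<and> n * n div 4 = f * f) \<or> (n = 2 * f + 1 \<and> n * n div 4 = f * f + f)"
    unfolding f_def by (rule quarter_square_cases)
  then show ?thesis
  proof
    assume A: "n = 2 * f \<and> n * n div 4 = f * f"
    then obtain j where j: "f = j + 1" using False by (metis mult_0_right not0_implies_Suc Suc_eq_plus1)
    then have "n - 1 = 2 * j + 1" using A by simp
    then have "(n - 1) * (n - 1) = 4 * (j * j + j) + 1" by (simp add: algebra_simps)
    then have "(n - 1) * (n - 1) div 4 = j * j + j" by simp
    then show ?thesis using A j by (simp add: f_def[symmetric])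
  next
    assume A: "n = 2 * f + 1 \<and> n * n div 4 = f * f + f"
    then have "n - 1 = 2 * f" by simp
    then have "(n - 1) * (n - 1) = 4 * (f * f)" by (simp add: mult.assoc mult.left_commute)
    then have "(n - 1) * (n - 1) div 4 = f * f" by simp
    then show ?thesis using A by (simp add: f_def[symmetric])
  qed
qed simp

lemma quarter_square_step:
  assumes "3 \<le> (n::nat)"
  shows "(n - 1) * (n - 1) div 4 = (n - 3) * (n - 3) div 4 + (n - 2)"
proof -
  obtain k where k: "n = k + 3" using assms by (metis add.commute le_Suc_ex)
  have "(n - 1) * (n - 1) = k * k + 4 * (k + 1)" by (simp add: k algebra_simps)
  then show ?thesis by (simp add: k)
qed

lemma floor_quarter_square: "\<lfloor>(real n)\<^sup>2 / 4\<rfloor> = int (n * n div 4)"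
  by (metis floor_divide_of_nat_eq of_nat_mult of_nat_numeral power2_eq_square)

section \<open>Graphs and their triangles\<close>

text \<open>
  Graphs are kept as a vertex set and a symmetric set of arcs, because the proofs delete edges and pass
  to induced subgraphs. Each edge contributes two arcs, so \<open>card E\<close> is twice the number of edges.
\<close>

definition simple_graph :: "'a set \<Rightarrow> ('a \<times> 'a) set \<Rightarrow> bool" where
  "simple_graph V E \<longleftrightarrow> finite V \<and> E \<subseteq> V \<times> V \<and> sym E \<and> irrefl E"

definition triangle_sets :: "('a \<times> 'a) set \<Rightarrow> 'a set set" where
  "triangle_sets E = {T. card T = 3 \<and> (\<forall>u\<in>T. \<forall>v\<in>T. u \<noteq> v \<longrightarrow> (u, v) \<in> E)}"

lemma simple_graphD:
  assumes "simple_graph V E"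
  shows "finite V" "E \<subseteq> V \<times> V" "finite E"
    and "(u, v) \<in> E \<Longrightarrow> (v, u) \<in> E" "(u, u) \<notin> E"
    and "(u, v) \<in> E \<Longrightarrow> u \<in> V" "(u, v) \<in> E \<Longrightarrow> v \<in> V"
  using assms by (auto simp: simple_graph_def sym_def irrefl_def intro: finite_subset)

lemma simple_graph_restrict:
  assumes "simple_graph V E"
  shows "simple_graph (V \<inter> W) (E \<inter> W \<times> W)"
  using assms by (auto simp: simple_graph_def sym_def irrefl_def)

lemma simple_graph_delete_edge:
  assumes "simple_graph V E"
  shows "simple_graph V (E - {(a, b), (b, a)})"
  using assms by (auto simp: simple_graph_def sym_def irrefl_def)

lemma card_delete_edge:
  assumes "simple_graph V E" "(a, b) \<in> E"
  shows "card E = card (E - {(a, b), (b, a)}) + 2"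
proof -
  have "(b, a) \<in> E" "a \<noteq> b"
    using simple_graphD[OF assms(1)] assms(2) by auto
  moreover have "card (E - {(a, b), (b, a)}) = card E - card {(a, b), (b, a)}"
    using assms(2) calculation by (intro card_Diff_subset) auto
  moreover have "card {(a, b), (b, a)} \<le> card E"
    using assms(2) calculation simple_graphD(3)[OF assms(1)] by (intro card_mono) auto
  ultimately show ?thesis by auto
qed

lemma even_card_arcs:
  assumes "simple_graph V E"
  shows "even (card E)"
  using assms
proof (induction "card E" arbitrary: E rule: less_induct)
  case less
  show ?case
  proof (cases "E = {}")
    case False
    then obtain a b where "(a, b) \<in> E" by auto
    then show ?thesis
      using card_delete_edge[OF less.prems] less.hyps[OF _ simple_graph_delete_edge[OF less.prems, of a b]]
      by simp
  qed simp
qed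

lemma triangle_sets_subset:
  assumes "simple_graph V E"
  shows "triangle_sets E \<subseteq> Pow V"
proof
  fix T assume T: "T \<in> triangle_sets E"
  then have c: "card T = 3" by (simp add: triangle_sets_def)
  show "T \<in> Pow V"
  proof
    show "T \<subseteq> V"
    proof
      fix x assume x: "x \<in> T"
      have "T \<noteq> {x}" using c by auto
      then obtain y where "y \<in> T" "y \<noteq> x" using x by auto
      then show "x \<in> V"
        using T x simple_graphD(6)[OF assms, of x y] by (auto simp: triangle_sets_def)
    qed
  qed
qed

lemma finite_triangle_sets:
  assumes "simple_graph V E"
  shows "finite (triangle_sets E)"
  using triangle_sets_subset[OF assms] simple_graphD(1)[OF assms]
  by (meson finite_Pow_iff finite_subset)

lemma triangle_sets_mono: "E \<subseteq> F \<Longrightarrow> triangle_sets E \<subseteq> triangle_sets F"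
  by (auto simp: triangle_sets_def)

lemma triangle_setI:
  assumes "simple_graph V E" "(x, y) \<in> E" "(y, z) \<in> E" "(x, z) \<in> E"
  shows "{x, y, z} \<in> triangle_sets E"
proof -
  have "x \<noteq> y" "y \<noteq> z" "x \<noteq> z"
    using simple_graphD(5)[OF assms(1)] assms(2-4) by auto
  then show ?thesis
    using simple_graphD(4)[OF assms(1)] assms(2-4) by (auto simp: triangle_sets_def)
qed

lemma triangle_setE:
  assumes "T \<in> triangle_sets E"
  obtains x y z where "T = {x, y, z}" "x \<noteq> y" "y \<noteq> z" "x \<noteq> z"
    "(x, y) \<in> E" "(y, z) \<in> E" "(x, z) \<in> E"
proof -
  from assms have "card T = 3" by (simp add: triangle_sets_def)
  then obtain x y z where "T = {x, y, z}" "x \<noteq> y" "y \<noteq> z" "x \<noteq> z"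
    by (auto simp: card_3_iff)
  then show ?thesis using that assms by (auto simp: triangle_sets_def)
qed

section \<open>Triangle-free graphs\<close>

text \<open>
  The neighbourhood \<open>A\<close> of a vertex of maximal degree contains no edge. Hence every edge meets the
  complement \<open>B\<close>, whose degrees add up to at most \<open>card A * card B\<close>. Equality forces every vertex of
  \<open>B\<close> to be joined to all of \<open>A\<close>.
\<close>

lemma triangle_free_bipartition:
  assumes G: "simple_graph V E" and free: "triangle_sets E = {}"
  obtains A B where "V = A \<union> B" "A \<inter> B = {}" "card E \<le> 2 * (card A * card B)"
    "card E = 2 * (card A * card B) \<Longrightarrow> E = A \<times> B \<union> B \<times> A"
proof (cases "V = {}")
  case True
  then show ?thesis using that[of "{}" "{}"] simple_graphD(2)[OF G] by auto
next
  case False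
  note fin = simple_graphD(1,3)[OF G]
  obtain u where u: "u \<in> V" and max: "\<And>v. v \<in> V \<Longrightarrow> card (E `` {v}) \<le> card (E `` {u})"
    using obtains_MAX[OF fin(1) False, of "\<lambda>v. card (E `` {v})"] Max_ge
    by (metis (no_types, lifting) fin(1) finite_imageI image_eqI)
  define A where "A = E `` {u}"
  define B where "B = V - A"
  have AV: "A \<subseteq> V" using simple_graphD(7)[OF G] by (auto simp: A_def)
  have finAB: "finite A" "finite B" using AV fin by (auto simp: B_def intro: finite_subset)
  have indep: "(a, a') \<notin> E" if "a \<in> A" "a' \<in> A" for a a'
    using triangle_setI[OF G, of u a a'] that free by (auto simp: A_def)
  have split: "E = (E \<inter> A \<times> B) \<union> (E \<inter> B \<times> V)"
    using simple_graphD(2)[OF G] indep by (auto simp: B_def)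
  have "bij_betw prod.swap (E \<inter> A \<times> B) (E \<inter> B \<times> A)"
    using simple_graphD(4)[OF G] by (intro bij_betw_byWitness[where f' = prod.swap]) auto
  then have swap: "card (E \<inter> A \<times> B) = card (E \<inter> B \<times> A)" by (rule bij_betw_same_card)
  have le1: "card (E \<inter> B \<times> A) \<le> card (E \<inter> B \<times> V)"
    using AV fin by (intro card_mono) auto
  have "E \<inter> B \<times> V = Sigma B (\<lambda>b. E `` {b})"
    using simple_graphD(7)[OF G] by auto
  then have "card (E \<inter> B \<times> V) = (\<Sum>b\<in>B. card (E `` {b}))"
    using finAB fin by (simp add: card_SigmaI finite_Image)
  also have "\<dots> \<le> (\<Sum>b\<in>B. card A)"
    unfolding A_def using max by (intro sum_mono) (auto simp: B_def)
  finally have le2: "card (E \<inter> B \<times> V) \<le> card A * card B" by (simp add: mult.commute)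
  have "E \<inter> A \<times> B \<inter> (E \<inter> B \<times> V) = {}" by (auto simp: B_def)
  then have cardE: "card E = card (E \<inter> A \<times> B) + card (E \<inter> B \<times> V)"
    using split fin by (metis card_Un_disjoint finite_Int)
  show ?thesis
  proof (rule that[of A B])
    show "V = A \<union> B" "A \<inter> B = {}" using AV by (auto simp: B_def)
    show "card E \<le> 2 * (card A * card B)" using cardE swap le1 le2 by simp
    assume "card E = 2 * (card A * card B)"
    then have eq: "card (E \<inter> B \<times> A) = card A * card B" "card (E \<inter> B \<times> V) = card (E \<inter> B \<times> A)"
      using cardE swap le1 le2 by simp_all
    have BA: "E \<inter> B \<times> A = B \<times> A"
      using finAB eq(1) by (intro card_subset_eq) (auto simp: card_cartesian_product)
    have "E \<inter> B \<times> A = E \<inter> B \<times> V"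
      using AV fin eq(2) by (intro card_subset_eq) auto
    then have BV: "E \<inter> B \<times> V = B \<times> A" using BA by simp
    have "E \<inter> A \<times> B = A \<times> B"
      using BA simple_graphD(4)[OF G] by blast
    then show "E = A \<times> B \<union> B \<times> A" using split BV by simp
  qed
qed

lemma mantel:
  assumes "simple_graph V E" "triangle_sets E = {}"
  shows "card E \<le> 2 * (card V * card V div 4)"
proof -
  obtain A B where AB: "V = A \<union> B" "A \<inter> B = {}" "card E \<le> 2 * (card A * card B)"
    using triangle_free_bipartition[OF assms] by metis
  have "card V = card A + card B"
    using AB simple_graphD(1)[OF assms(1)] by (simp add: card_Un_disjoint)
  then show ?thesis using AB(3) mult_le_quarter_square[of "card A" "card B"] by simp
qed

lemma mantel_extremal:
  assumes "simple_graph V E" "triangle_sets E = {}" "card E = 2 * (card V * card V div 4)"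
  obtains A B where "V = A \<union> B" "A \<inter> B = {}" "E = A \<times> B \<union> B \<times> A"
    "card V = card A + card B" "card A * card B = card V * card V div 4"
proof -
  obtain A B where AB: "V = A \<union> B" "A \<inter> B = {}" "card E \<le> 2 * (card A * card B)"
    "card E = 2 * (card A * card B) \<Longrightarrow> E = A \<times> B \<union> B \<times> A"
    using triangle_free_bipartition[OF assms(1,2)] by metis
  have V: "card V = card A + card B"
    using AB simple_graphD(1)[OF assms(1)] by (simp add: card_Un_disjoint)
  then have "card A * card B = card V * card V div 4"
    using AB(3) mult_le_quarter_square[of "card A" "card B"] assms(3) by simp
  then show ?thesis using that[of A B] AB V assms(3) by simp
qed

section \<open>Counting around a triangle\<close>

lemma triangle_neighbourhood_arcs:
  assumes G: "simple_graph V E"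
    and xyz: "(x, y) \<in> E" "(y, z) \<in> E" "(x, z) \<in> E"
  defines "W \<equiv> V - {x, y, z}"
  shows "card E = 6 + 2 * (card (E `` {x} \<inter> W) + card (E `` {y} \<inter> W) + card (E `` {z} \<inter> W))
    + card (E \<inter> W \<times> W)"
proof -
  note fin = simple_graphD(1,3)[OF G]
  have V: "x \<in> V" "y \<in> V" "z \<in> V" and d: "x \<noteq> y" "y \<noteq> z" "x \<noteq> z"
    using simple_graphD[OF G] xyz by auto
  let ?T = "{x, y, z}"
  have finW: "finite W" using fin by (simp add: W_def)
  have TT: "E \<inter> ?T \<times> ?T = {(x, y), (y, x), (y, z), (z, y), (x, z), (z, x)}"
    using xyz simple_graphD(4,5)[OF G] by auto
  have cTT: "card (E \<inter> ?T \<times> ?T) = 6"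
    unfolding TT using d by (simp add: card_insert_if)
  have "E \<inter> ?T \<times> W = Sigma ?T (\<lambda>v. E `` {v} \<inter> W)" by auto
  then have cTW: "card (E \<inter> ?T \<times> W) =
      card (E `` {x} \<inter> W) + card (E `` {y} \<inter> W) + card (E `` {z} \<inter> W)"
    using d finW by (simp add: card_SigmaI)
  have "bij_betw prod.swap (E \<inter> ?T \<times> W) (E \<inter> W \<times> ?T)"
    using simple_graphD(4)[OF G] by (intro bij_betw_byWitness[where f' = prod.swap]) auto
  then have swap: "card (E \<inter> ?T \<times> W) = card (E \<inter> W \<times> ?T)" by (rule bij_betw_same_card)
  have split: "card F = card (F \<inter> S \<times> ?T) + card (F \<inter> S \<times> W)" if "F \<subseteq> S \<times> V" "finite F" for F S
  proof -
    have "F = (F \<inter> S \<times> ?T) \<union> (F \<inter> S \<times> W)"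
      using that(1) by (auto simp: W_def)
    moreover have "(F \<inter> S \<times> ?T) \<inter> (F \<inter> S \<times> W) = {}"
      by (auto simp: W_def)
    ultimately show ?thesis using that(2) by (metis card_Un_disjoint finite_Int)
  qed
  have "E = (E \<inter> ?T \<times> V) \<union> (E \<inter> W \<times> V)" "(E \<inter> ?T \<times> V) \<inter> (E \<inter> W \<times> V) = {}"
    using simple_graphD(2)[OF G] by (auto simp: W_def)
  then have "card E = card (E \<inter> ?T \<times> V) + card (E \<inter> W \<times> V)"
    using fin by (metis card_Un_disjoint finite_Int)
  also have "card (E \<inter> ?T \<times> V) = card (E \<inter> ?T \<times> ?T) + card (E \<inter> ?T \<times> W)"
  proof -
    have "E \<inter> ?T \<times> V \<inter> ?T \<times> ?T = E \<inter> ?T \<times> ?T" "E \<inter> ?T \<times> V \<inter> ?T \<times> W = E \<inter> ?T \<times> W"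
      using V by (auto simp: W_def)
    then show ?thesis using split[of "E \<inter> ?T \<times> V" ?T] fin by simp
  qed
  also have "card (E \<inter> W \<times> V) = card (E \<inter> W \<times> ?T) + card (E \<inter> W \<times> W)"
  proof -
    have "E \<inter> W \<times> V \<inter> W \<times> ?T = E \<inter> W \<times> ?T" "E \<inter> W \<times> V \<inter> W \<times> W = E \<inter> W \<times> W"
      using V by (auto simp: W_def)
    then show ?thesis using split[of "E \<inter> W \<times> V" W] fin by simp
  qed
  finally show ?thesis using cTT cTW swap by simp
qed

text \<open>
  A common neighbour of two vertices of the triangle yields a further triangle on their edge, and all
  these are distinct from each other, from the given triangle, and from those without an edge in common
  with it.
\<close>

lemma triangle_neighbourhood_triangles:
  assumes G: "simple_graph V E"
    and xyz: "(x, y) \<in> E" "(y, z) \<in> E" "(x, z) \<in> E"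
  defines "W \<equiv> V - {x, y, z}"
  shows "card (E `` {x} \<inter> W \<inter> (E `` {y} \<inter> W)) + card (E `` {y} \<inter> W \<inter> (E `` {z} \<inter> W))
      + card (E `` {x} \<inter> W \<inter> (E `` {z} \<inter> W))
      + card {T \<in> triangle_sets E. \<not> {x, y} \<subseteq> T \<and> \<not> {y, z} \<subseteq> T \<and> \<not> {x, z} \<subseteq> T} + 1
    \<le> card (triangle_sets E)"
proof -
  note fin = simple_graphD(1,3)[OF G]
  have d: "x \<noteq> y" "y \<noteq> z" "x \<noteq> z"
    using simple_graphD[OF G] xyz by auto
  have finW: "finite W" using fin by (simp add: W_def)
  let ?X = "E `` {x} \<inter> W" and ?Y = "E `` {y} \<inter> W" and ?Z = "E `` {z} \<inter> W"
  let ?R = "{T \<in> triangle_sets E. \<not> {x, y} \<subseteq> T \<and> \<not> {y, z} \<subseteq> T \<and> \<not> {x, z} \<subseteq> T}"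
  define a where "a = (\<lambda>w. {x, y, w}) ` (?X \<inter> ?Y)"
  define b where "b = (\<lambda>w. {y, z, w}) ` (?Y \<inter> ?Z)"
  define c where "c = (\<lambda>w. {x, z, w}) ` (?X \<inter> ?Z)"
  have ca: "card a = card (?X \<inter> ?Y)"
    unfolding a_def by (rule card_image) (auto simp: inj_on_def W_def)
  have cb: "card b = card (?Y \<inter> ?Z)"
    unfolding b_def by (rule card_image) (auto simp: inj_on_def W_def)
  have cc: "card c = card (?X \<inter> ?Z)"
    unfolding c_def by (rule card_image) (auto simp: inj_on_def W_def)
  have f: "finite a" "finite b" "finite c" "finite ?R"
    using finW finite_triangle_sets[OF G] by (auto simp: a_def b_def c_def)
  have A: "{x, y} \<subseteq> T" "z \<notin> T" if "T \<in> a" for T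
    using that d by (auto simp: a_def W_def)
  have B: "{y, z} \<subseteq> T" "x \<notin> T" if "T \<in> b" for T
    using that d by (auto simp: b_def W_def)
  have C: "{x, z} \<subseteq> T" "y \<notin> T" if "T \<in> c" for T
    using that d by (auto simp: c_def W_def)
  have "a \<inter> b = {}" "(a \<union> b) \<inter> c = {}" "(a \<union> b \<union> c) \<inter> ?R = {}" "{x, y, z} \<notin> a \<union> b \<union> c \<union> ?R"
    using A B C by blast+
  then have "card (insert {x, y, z} (a \<union> b \<union> c \<union> ?R)) = card a + card b + card c + card ?R + 1"
    using f by (simp add: card_Un_disjoint)
  moreover have "insert {x, y, z} (a \<union> b \<union> c \<union> ?R) \<subseteq> triangle_sets E"
    using triangle_setI[OF G] xyz by (auto simp: a_def b_def c_def)
  from card_mono[OF finite_triangle_sets[OF G] this]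
  have "card (insert {x, y, z} (a \<union> b \<union> c \<union> ?R)) \<le> card (triangle_sets E)" .
  ultimately show ?thesis
    by (simp only: ca cb cc)
qed

lemma card_three_sets_le:
  assumes "finite X" "finite Y" "finite Z"
  shows "card X + card Y + card Z \<le>
    card (X \<union> Y \<union> Z) + card (X \<inter> Y) + card (Y \<inter> Z) + card (X \<inter> Z)"
proof -
  have "card X + card Y = card (X \<union> Y) + card (X \<inter> Y)"
    by (intro card_Un_Int) (use assms in auto)
  moreover have "card (X \<union> Y) + card Z = card (X \<union> Y \<union> Z) + card ((X \<union> Y) \<inter> Z)"
    by (intro card_Un_Int) (use assms in auto)
  moreover have "card ((X \<union> Y) \<inter> Z) \<le> card (X \<inter> Z) + card (Y \<inter> Z)"
    by (metis Int_Un_distrib2 card_Un_le)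
  ultimately show ?thesis by linarith
qed

lemma triangle_sets_away_subset:
  assumes "W \<inter> {x, y, z} = {}"
  shows "triangle_sets (E \<inter> W \<times> W) \<subseteq>
    {T \<in> triangle_sets E. \<not> {x, y} \<subseteq> T \<and> \<not> {y, z} \<subseteq> T \<and> \<not> {x, z} \<subseteq> T}"
proof
  fix T assume T: "T \<in> triangle_sets (E \<inter> W \<times> W)"
  have "T \<subseteq> W" using T by (elim triangle_setE) auto
  then show "T \<in> {T \<in> triangle_sets E. \<not> {x, y} \<subseteq> T \<and> \<not> {y, z} \<subseteq> T \<and> \<not> {x, z} \<subseteq> T}"
    using T assms triangle_sets_mono[of "E \<inter> W \<times> W" E] by blast
qed

lemma card_outside_triangle:
  assumes "simple_graph V E" "(x, y) \<in> E" "(y, z) \<in> E" "(x, z) \<in> E"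
  shows "card (V - {x, y, z}) = card V - 3" "3 \<le> card V"
proof -
  have "x \<in> V" "y \<in> V" "z \<in> V" "x \<noteq> y" "y \<noteq> z" "x \<noteq> z"
    using simple_graphD[OF assms(1)] assms(2-4) by auto
  then have "{x, y, z} \<subseteq> V" "card {x, y, z} = 3" by auto
  then show "card (V - {x, y, z}) = card V - 3" "3 \<le> card V"
    using simple_graphD(1)[OF assms(1)] by (metis card_Diff_subset finite_subset, metis card_mono)
qed

text \<open>
  Vertices joined to several vertices of the triangle are what makes the number of edges leaving it
  exceed \<open>card V - 3\<close>; the excess is paid for by the triangles they create.
\<close>

lemma triangle_arcs_le:
  assumes G: "simple_graph V E"
    and xyz: "(x, y) \<in> E" "(y, z) \<in> E" "(x, z) \<in> E"
  defines "W \<equiv> V - {x, y, z}"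
  defines "X \<equiv> E `` {x} \<inter> W" and "Y \<equiv> E `` {y} \<inter> W" and "Z \<equiv> E `` {z} \<inter> W"
  shows "card E \<le> 6 + 2 * (card (X \<union> Y \<union> Z) + (card (X \<inter> Y) + card (Y \<inter> Z) + card (X \<inter> Z)))
    + card (E \<inter> W \<times> W)"
proof -
  have "finite W" using simple_graphD(1)[OF G] by (simp add: W_def)
  then have "card X + card Y + card Z \<le>
      card (X \<union> Y \<union> Z) + card (X \<inter> Y) + card (Y \<inter> Z) + card (X \<inter> Z)"
    by (intro card_three_sets_le) (auto simp: X_def Y_def Z_def)
  moreover have "card E = 6 + 2 * (card X + card Y + card Z) + card (E \<inter> W \<times> W)"
    using triangle_neighbourhood_arcs[OF G xyz] by (simp add: X_def Y_def Z_def W_def)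
  ultimately show ?thesis by simp
qed

section \<open>Many edges and one triangle force many triangles\<close>

text \<open>
  If there are two triangles, deleting an edge of one of them that is not in the other keeps a triangle
  and loses at least one, so the claim follows by induction. If the triangle is unique, no outer vertex
  is joined to two of its vertices, and the graph outside is triangle-free. The sum of the two bounds is
  exact because \<open>(n - 1)\<^sup>2 div 4\<close> exceeds \<open>(n - 3)\<^sup>2 div 4\<close> by \<open>n - 2\<close>.
\<close>

lemma arcs_le_triangle_count:
  assumes "simple_graph V E" "triangle_sets E \<noteq> {}"
  shows "card E \<le> 2 * ((card V - 1) * (card V - 1) div 4 + card (triangle_sets E) + 1)"
  using assms
proof (induction "card E" arbitrary: E rule: less_induct)
  case less
  note G = less.prems(1)
  obtain T1 where T1: "T1 \<in> triangle_sets E" using less.prems(2) by auto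
  show ?case
  proof (cases "triangle_sets E = {T1}")
    case True
    obtain x y z where T: "T1 = {x, y, z}" and xyz: "(x, y) \<in> E" "(y, z) \<in> E" "(x, z) \<in> E"
      using triangle_setE[OF T1] by metis
    let ?n = "card V"
    define W where "W = V - {x, y, z}"
    define X where "X = E `` {x} \<inter> W"
    define Y where "Y = E `` {y} \<inter> W"
    define Z where "Z = E `` {z} \<inter> W"
    note defs = W_def X_def Y_def Z_def
    have n: "3 \<le> ?n" and cW: "card W = ?n - 3" and finW: "finite W"
      using card_outside_triangle[OF G xyz] simple_graphD(1)[OF G] by (simp_all add: W_def)
    let ?R = "{T \<in> triangle_sets E. \<not> {x, y} \<subseteq> T \<and> \<not> {y, z} \<subseteq> T \<and> \<not> {x, z} \<subseteq> T}"
    have few: "card (X \<inter> Y) + card (Y \<inter> Z) + card (X \<inter> Z) + card ?R + 1 \<le> card (triangle_sets E)"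
      using triangle_neighbourhood_triangles[OF G xyz] by (simp only: defs)
    have zero: "card (X \<inter> Y) + card (Y \<inter> Z) + card (X \<inter> Z) = 0"
      using few True by simp
    have "?R = {}" unfolding True T by auto
    then have free: "triangle_sets (E \<inter> W \<times> W) = {}"
      using triangle_sets_away_subset[of W x y z E] by (auto simp: W_def)
    have GW: "simple_graph W (E \<inter> W \<times> W)"
      using simple_graph_restrict[OF G, of W] by (simp add: W_def Int_absorb1 Diff_subset)
    have "card (E \<inter> W \<times> W) \<le> 2 * ((?n - 3) * (?n - 3) div 4)"
      using mantel[OF GW free] cW by simp
    moreover have "card (X \<union> Y \<union> Z) \<le> ?n - 3"
      unfolding cW[symmetric] using finW by (intro card_mono) (auto simp: X_def Y_def Z_def)
    moreover have "card E \<le> 6 + 2 * (card (X \<union> Y \<union> Z) + (card (X \<inter> Y) + card (Y \<inter> Z) + card (X \<inter> Z)))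
        + card (E \<inter> W \<times> W)"
      using triangle_arcs_le[OF G xyz] by (simp only: defs)
    ultimately have "card E \<le> 6 + 2 * (?n - 3) + 2 * ((?n - 3) * (?n - 3) div 4)"
      using zero by simp
    moreover obtain k where "?n = k + 3" using n by (metis add.commute le_Suc_ex)
    ultimately show ?thesis
      using quarter_square_step[OF n] True by simp
  next
    case False
    then obtain T2 where T2: "T2 \<in> triangle_sets E" "T2 \<noteq> T1" using T1 by auto
    have c: "card T1 = 3" "card T2 = 3" using T1 T2 by (auto simp: triangle_sets_def)
    then have "\<not> T1 \<subseteq> T2" using T2(2) by (metis card_subset_eq card.infinite zero_neq_numeral)
    then obtain a where a: "a \<in> T1" "a \<notin> T2" by auto
    have "T1 \<noteq> {a}" using c by auto
    then obtain b where b: "b \<in> T1" "b \<noteq> a" using a by auto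
    have ab: "(a, b) \<in> E" using T1 a b by (auto simp: triangle_sets_def)
    define E' where "E' = E - {(a, b), (b, a)}"
    have G': "simple_graph V E'" unfolding E'_def by (rule simple_graph_delete_edge[OF G])
    have cE: "card E = card E' + 2" unfolding E'_def by (rule card_delete_edge[OF G ab])
    have sub: "triangle_sets E' \<subseteq> triangle_sets E - {T1}"
      using a b by (auto simp: triangle_sets_def E'_def)
    have "T2 \<in> triangle_sets E'" using T2(1) a(2) by (auto simp: triangle_sets_def E'_def)
    then have "card E' \<le> 2 * ((card V - 1) * (card V - 1) div 4 + card (triangle_sets E') + 1)"
      using less.hyps[OF _ G'] cE by auto
    moreover have "card (triangle_sets E') + 1 \<le> card (triangle_sets E)"
      using card_mono[OF _ sub] finite_triangle_sets[OF G] T1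
      by (metis Suc_eq_plus1 Suc_le_mono card_Suc_Diff1 finite_Diff)
    ultimately show ?thesis using cE by simp
  qed
qed

section \<open>The case of equality\<close>

text \<open>
  The complete bipartite graph with sides \<open>{x, y} \<union> Q\<close> and \<open>C \<union> X \<union> Y\<close>, with the edge \<open>x y\<close> added
  and the edges from \<open>x\<close> to \<open>Y\<close> and from \<open>y\<close> to \<open>X\<close> removed; its triangles are the \<open>{x, y, c}\<close> with
  \<open>c \<in> C\<close>. It is described by its neighbourhoods, which is the form in which sums over
  neighbours are evaluated later.
\<close>

definition defective_bipartite ::
  "'a set \<Rightarrow> ('a \<times> 'a) set \<Rightarrow> 'a \<Rightarrow> 'a \<Rightarrow> 'a set \<Rightarrow> 'a set \<Rightarrow> 'a set \<Rightarrow> 'a set \<Rightarrow> bool" where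
  "defective_bipartite V E x y C X Y Q \<longleftrightarrow>
     V = {x, y} \<union> Q \<union> (C \<union> X \<union> Y) \<and> x \<noteq> y \<and> {x, y} \<inter> Q = {} \<and>
     ({x, y} \<union> Q) \<inter> (C \<union> X \<union> Y) = {} \<and> C \<inter> X = {} \<and> C \<inter> Y = {} \<and> X \<inter> Y = {} \<and>
     E `` {x} = {y} \<union> C \<union> X \<and> E `` {y} = {x} \<union> C \<union> Y \<and>
     (\<forall>u\<in>Q. E `` {u} = C \<union> X \<union> Y) \<and> (\<forall>u\<in>C. E `` {u} = {x, y} \<union> Q) \<and>
     (\<forall>u\<in>X. E `` {u} = {x} \<union> Q) \<and> (\<forall>u\<in>Y. E `` {u} = {y} \<union> Q)"

lemma defective_bipartite_swap:
  "defective_bipartite V E x y C X Y Q \<Longrightarrow> defective_bipartite V E y x C Y X Q"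
  unfolding defective_bipartite_def
  by (simp only: insert_commute[of x y] Un_assoc Un_commute[of X Y] Un_left_commute[of X Y]
      Int_commute[of X Y] eq_commute[of x y]) simp

text \<open>
  All estimates around any chosen triangle must be tight. The point to exclude is a triangle among the
  vertices \<open>W\<close> away from it: then \<open>arcs_le_triangle_count\<close>, applied inside \<open>W\<close>, replaces Mantel's
  bound for \<open>W\<close> by one that is too small as soon as \<open>7 \<le> card V\<close>. The prism, that is two disjoint
  triangles joined by a perfect matching, shows that this fails for six vertices and two triangles.
\<close>

lemma near_extremal_counts:
  assumes G: "simple_graph V E"
    and xyz: "(x, y) \<in> E" "(y, z) \<in> E" "(x, z) \<in> E"
    and large: "7 \<le> card V \<or> card (triangle_sets E) = 1"
    and eq: "card E = 2 * ((card V - 1) * (card V - 1) div 4 + card (triangle_sets E) + 1)"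
  defines "W \<equiv> V - {x, y, z}"
  defines "X \<equiv> E `` {x} \<inter> W" and "Y \<equiv> E `` {y} \<inter> W" and "Z \<equiv> E `` {z} \<inter> W"
  shows "triangle_sets (E \<inter> W \<times> W) = {}"
    and "card (E \<inter> W \<times> W) = 2 * (card W * card W div 4)"
    and "X \<union> Y \<union> Z = W"
    and "card (X \<inter> Y) + card (Y \<inter> Z) + card (X \<inter> Z) + 1 = card (triangle_sets E)"
    and "{T \<in> triangle_sets E. \<not> {x, y} \<subseteq> T \<and> \<not> {y, z} \<subseteq> T \<and> \<not> {x, z} \<subseteq> T} = {}"
proof -
  let ?n = "card V" and ?t = "card (triangle_sets E)"
  define R where "R = {T \<in> triangle_sets E. \<not> {x, y} \<subseteq> T \<and> \<not> {y, z} \<subseteq> T \<and> \<not> {x, z} \<subseteq> T}"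
  note defs = W_def X_def Y_def Z_def R_def
  have n: "3 \<le> ?n" and cW: "card W = ?n - 3" and finW: "finite W"
    using card_outside_triangle[OF G xyz] simple_graphD(1)[OF G] by (simp_all add: W_def)
  have finR: "finite R" using finite_triangle_sets[OF G] by (simp add: R_def)
  define s where "s = card (X \<inter> Y) + card (Y \<inter> Z) + card (X \<inter> Z)"
  have few: "s + card R + 1 \<le> ?t"
    using triangle_neighbourhood_triangles[OF G xyz] by (simp only: defs s_def)
  have U: "X \<union> Y \<union> Z \<subseteq> W" by (auto simp: X_def Y_def Z_def)
  obtain k where k: "?n = k + 3" using n by (metis add.commute le_Suc_ex)
  then have cWk: "card W = k" using cW by simp
  have cU: "card (X \<union> Y \<union> Z) \<le> k"
    unfolding cWk[symmetric] using finW U by (intro card_mono)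
  have arcs: "card E \<le> 6 + 2 * (card (X \<union> Y \<union> Z) + s) + card (E \<inter> W \<times> W)"
    using triangle_arcs_le[OF G xyz] by (simp only: defs s_def)
  have GW: "simple_graph W (E \<inter> W \<times> W)"
    using simple_graph_restrict[OF G, of W] by (simp add: W_def Int_absorb1 Diff_subset)
  have awaysub: "triangle_sets (E \<inter> W \<times> W) \<subseteq> R"
    unfolding R_def by (rule triangle_sets_away_subset) (auto simp: W_def)
  have tW: "card (triangle_sets (E \<inter> W \<times> W)) \<le> card R"
    by (rule card_mono[OF finR awaysub])
  define q1 where "q1 = (?n - 1) * (?n - 1) div 4"
  define q3 where "q3 = (?n - 3) * (?n - 3) div 4"
  define q4 where "q4 = (?n - 4) * (?n - 4) div 4"
  have step: "q1 = q3 + (k + 1)"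
    using quarter_square_step[OF n] by (simp add: q1_def q3_def k)
  have eq': "card E = 2 * (q1 + ?t + 1)" using eq by (simp add: q1_def)
  show free: "triangle_sets (E \<inter> W \<times> W) = {}"
  proof (rule ccontr)
    assume ne: "triangle_sets (E \<inter> W \<times> W) \<noteq> {}"
    \<comment> \<open>Such a triangle is counted in \<open>R\<close>, hence it is a second one.\<close>
    then have "card (triangle_sets (E \<inter> W \<times> W)) \<noteq> 0"
      using finite_triangle_sets[OF GW] by simp
    then have n7: "7 \<le> ?n" using large tW few k by linarith
    have "card (E \<inter> W \<times> W) \<le> 2 * (q4 + card (triangle_sets (E \<inter> W \<times> W)) + 1)"
      using arcs_le_triangle_count[OF GW ne] cW by (simp add: q4_def k)
    then have "card E \<le> 2 * (k + 3 + (q4 + ?t))"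
      using arcs cU tW few by simp
    then have "q3 \<le> q4 + 1"
      using eq' step by simp
    moreover have "q4 + 2 \<le> q3"
    proof -
      have i: "(i + 1) * (i + 1) div 4 \<ge> i * i div 4 + 2" if "3 \<le> i" for i :: nat
      proof (cases "i = 3")
        case False
        then have "i * i + 8 \<le> (i + 1) * (i + 1)" using that by simp
        then have "(i * i + 8) div 4 \<le> (i + 1) * (i + 1) div 4" by (rule div_le_mono)
        then show ?thesis by simp
      qed simp
      have "?n - 3 = ?n - 4 + 1" using n7 by simp
      then show ?thesis using i[of "?n - 4"] n7 by (simp only: q3_def q4_def)
    qed
    ultimately show False by linarith
  qed
  have mW: "card (E \<inter> W \<times> W) \<le> 2 * (q3)"
    using mantel[OF GW free] cW by (simp add: q3_def)
  have "card (X \<union> Y \<union> Z) = k \<and> s + 1 = ?t \<and> card R = 0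
      \<and> card (E \<inter> W \<times> W) = 2 * (q3)"
    using arcs mW cU few eq' step by arith
  then have tight: "card (X \<union> Y \<union> Z) = k" "s + 1 = ?t" "card R = 0"
      "card (E \<inter> W \<times> W) = 2 * q3"
    by simp_all
  show "X \<union> Y \<union> Z = W"
    using finW U tight(1) cWk by (intro card_subset_eq) auto
  show "card (X \<inter> Y) + card (Y \<inter> Z) + card (X \<inter> Z) + 1 = ?t"
    using tight(2) by (simp add: s_def)
  show "{T \<in> triangle_sets E. \<not> {x, y} \<subseteq> T \<and> \<not> {y, z} \<subseteq> T \<and> \<not> {x, z} \<subseteq> T} = {}"
    using tight(3) finR by (simp add: R_def)
  show "card (E \<inter> W \<times> W) = 2 * (card W * card W div 4)"
    using tight(4) by (simp add: cWk q3_def k)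
qed

text \<open>
  As the neighbours outside the triangle are in \<open>Q\<close> for \<open>z\<close> and in \<open>P\<close> for \<open>x\<close> and \<open>y\<close>, the vertex \<open>z\<close> belongs
  to the side of \<open>P\<close>, and \<open>x\<close>, \<open>y\<close> belong to the side of \<open>Q\<close>. The common neighbours of \<open>x\<close> and \<open>y\<close> are \<open>z\<close> and those in \<open>P\<close>.
\<close>

lemma defective_bipartite_from_triangle:
  assumes G: "simple_graph V E"
    and xyz: "(x, y) \<in> E" "(y, z) \<in> E" "(x, z) \<in> E"
    and W: "V - {x, y, z} = P \<union> Q" "P \<inter> Q = {}"
    and EW: "E \<inter> (P \<union> Q) \<times> (P \<union> Q) = P \<times> Q \<union> Q \<times> P"
    and sides: "E `` {x} \<inter> (P \<union> Q) \<subseteq> P" "E `` {y} \<inter> (P \<union> Q) \<subseteq> P" "E `` {z} \<inter> (P \<union> Q) \<subseteq> Q"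
    and cover: "P \<union> Q \<subseteq> E `` {x} \<union> E `` {y} \<union> E `` {z}"
  shows "defective_bipartite V E x y (insert z (E `` {x} \<inter> E `` {y} \<inter> P))
    (P - E `` {y}) (P - E `` {x}) Q"
proof -
  have V: "V = {x, y, z} \<union> (P \<union> Q)" and d: "x \<noteq> y" "y \<noteq> z" "x \<noteq> z"
    and nW: "x \<notin> P \<union> Q" "y \<notin> P \<union> Q" "z \<notin> P \<union> Q"
    using W(1) xyz simple_graphD[OF G] by auto
  have sym: "(u, v) \<in> E \<longleftrightarrow> (v, u) \<in> E" for u v using simple_graphD(4)[OF G] by blast
  have irr: "(u, u) \<notin> E" for u using simple_graphD(5)[OF G] by blast
  have inV: "v \<in> V" if "(u, v) \<in> E" for u v using simple_graphD(7)[OF G that] .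
  have PQ: "(u, v) \<in> E \<longleftrightarrow> (u \<in> P \<and> v \<in> Q) \<or> (u \<in> Q \<and> v \<in> P)" if "u \<in> P \<union> Q" "v \<in> P \<union> Q" for u v
    using EW that by blast
  have xQ: "(x, v) \<notin> E" "(y, v) \<notin> E" "(z, v) \<in> E" if "v \<in> Q" for v
    using sides W(2) cover that by blast+
  have zP: "(z, v) \<notin> E" "(x, v) \<in> E \<or> (y, v) \<in> E" if "v \<in> P" for v
    using sides W(2) cover that by blast+
  have nx: "v \<in> E `` {x} \<longleftrightarrow> v = y \<or> v = z \<or> (v \<in> P \<and> (x, v) \<in> E)" for v
    using V xQ(1) inV[of x v] irr[of x] xyz by auto
  have ny: "v \<in> E `` {y} \<longleftrightarrow> v = x \<or> v = z \<or> (v \<in> P \<and> (y, v) \<in> E)" for v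
    using V xQ(2) inV[of y v] irr[of y] xyz sym[of y x] by auto
  have nz: "v \<in> E `` {z} \<longleftrightarrow> v = x \<or> v = y \<or> v \<in> Q" for v
    using V xQ(3) zP(1) inV[of z v] irr[of z] xyz sym[of z x] sym[of z y] by auto
  have nP: "v \<in> E `` {p} \<longleftrightarrow> v \<in> Q \<or> (v = x \<and> (x, p) \<in> E) \<or> (v = y \<and> (y, p) \<in> E)" if "p \<in> P" for p v
    using V PQ[of p v] W(2) that zP(1)[OF that] inV[of p v] sym[of p v] nW by auto
  have nQ: "v \<in> E `` {q} \<longleftrightarrow> v \<in> P \<or> v = z" if "q \<in> Q" for q v
    using V PQ[of q v] W(2) that xQ[OF that] inV[of q v] sym[of q v] nW by auto
  show ?thesis
    unfolding defective_bipartite_def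
  proof (intro conjI ballI)
    show "V = {x, y} \<union> Q \<union> (insert z (E `` {x} \<inter> E `` {y} \<inter> P) \<union> (P - E `` {y}) \<union> (P - E `` {x}))"
      using V by blast
    show "x \<noteq> y" "{x, y} \<inter> Q = {}" using d nW by auto
    show "({x, y} \<union> Q) \<inter> (insert z (E `` {x} \<inter> E `` {y} \<inter> P) \<union> (P - E `` {y}) \<union> (P - E `` {x})) = {}"
      using d nW W(2) by blast
    show "insert z (E `` {x} \<inter> E `` {y} \<inter> P) \<inter> (P - E `` {y}) = {}"
      "insert z (E `` {x} \<inter> E `` {y} \<inter> P) \<inter> (P - E `` {x}) = {}"
      using nW by blast+
    show "(P - E `` {y}) \<inter> (P - E `` {x}) = {}" using zP(2) by blast
    show "E `` {x} = {y} \<union> insert z (E `` {x} \<inter> E `` {y} \<inter> P) \<union> (P - E `` {y})"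
      using nx zP(2) by blast
    show "E `` {y} = {x} \<union> insert z (E `` {x} \<inter> E `` {y} \<inter> P) \<union> (P - E `` {x})"
      using ny zP(2) by blast
  next
    fix u assume "u \<in> Q"
    then show "E `` {u} = insert z (E `` {x} \<inter> E `` {y} \<inter> P) \<union> (P - E `` {y}) \<union> (P - E `` {x})"
      using nQ by blast
  next
    fix u assume "u \<in> insert z (E `` {x} \<inter> E `` {y} \<inter> P)"
    then show "E `` {u} = {x, y} \<union> Q"
      using nz nP by blast
  next
    fix u assume "u \<in> P - E `` {y}"
    then show "E `` {u} = {x} \<union> Q" using nP zP(2) by blast
  next
    fix u assume "u \<in> P - E `` {x}"
    then show "E `` {u} = {y} \<union> Q" using nP zP(2) by blast
  qed
qed

text \<open>
  Outside a triangle the graph is complete bipartite, with sides \<open>P\<close> and \<open>Q\<close>, by the case of equality in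
  Mantel's theorem. A triangle vertex joined to both sides would create a triangle sharing only that
  vertex, so each of the three is joined to one side only; as together they reach everything, one side is
  reached by a single one of them.
\<close>

lemma near_extremal_structure:
  assumes G: "simple_graph V E"
    and ne: "triangle_sets E \<noteq> {}"
    and six: "6 \<le> card V"
    and large: "7 \<le> card V \<or> card (triangle_sets E) = 1"
    and eq: "card E = 2 * ((card V - 1) * (card V - 1) div 4 + card (triangle_sets E) + 1)"
  obtains x y C X Y Q where "defective_bipartite V E x y C X Y Q"
    "card C = card (triangle_sets E)"
    "card C + card X + card Y + card Q + 2 = card V"
    "(card C + card X + card Y - 1) * card Q = (card V - 3) * (card V - 3) div 4"
proof -
  note result = that
  obtain T where "T \<in> triangle_sets E" using ne by auto
  then obtain x y z where xyz: "(x, y) \<in> E" "(y, z) \<in> E" "(x, z) \<in> E"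
    using triangle_setE by metis
  define W where "W = V - {x, y, z}"
  note counts = near_extremal_counts[OF G xyz large eq, folded W_def]
  have finW: "finite W" using simple_graphD(1)[OF G] by (simp add: W_def)
  have cW: "card W = card V - 3"
    using card_outside_triangle[OF G xyz] by (simp add: W_def)
  have GW: "simple_graph W (E \<inter> W \<times> W)"
    using simple_graph_restrict[OF G, of W] by (simp add: W_def Int_absorb1 Diff_subset)
  obtain P Q where PQ: "W = P \<union> Q" "P \<inter> Q = {}" "E \<inter> W \<times> W = P \<times> Q \<union> Q \<times> P"
    "card W = card P + card Q" "card P * card Q = card W * card W div 4"
    using mantel_extremal[OF GW counts(1,2)] by metis
  have finPQ: "finite P" "finite Q" using finW PQ(1) by simp_all
  have "3 * 3 \<le> card W * card W" using six cW by (intro mult_le_mono) auto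
  then have "card P * card Q \<noteq> 0" using PQ(5) by simp
  then have nonempty: "P \<noteq> {}" "Q \<noteq> {}" by auto
  have indep: "E `` {v} \<inter> W \<subseteq> P \<or> E `` {v} \<inter> W \<subseteq> Q" if v: "v \<in> {x, y, z}" for v
  proof (rule ccontr)
    assume "\<not> ?thesis"
    then obtain p q where pq: "p \<in> P" "q \<in> Q" "(v, p) \<in> E" "(v, q) \<in> E" "p \<in> W" "q \<in> W"
      using PQ(1) by blast
    then have "{v, p, q} \<in> triangle_sets E"
      using triangle_setI[OF G, of v p q] PQ(3) by blast
    moreover have "\<not> {x, y} \<subseteq> {v, p, q}" "\<not> {y, z} \<subseteq> {v, p, q}" "\<not> {x, z} \<subseteq> {v, p, q}"
      using pq(5,6) xyz simple_graphD(5)[OF G] by (auto simp: W_def)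
    ultimately show False using counts(5) by blast
  qed
  have cover: "W \<subseteq> E `` {x} \<union> E `` {y} \<union> E `` {z}" using counts(3) by blast
  \<comment> \<open>The conclusion when the triangle is labelled such that its third vertex alone reaches \<open>B\<close>.\<close>
  have finish: thesis
    if ab: "(a, b) \<in> E" "(b, c) \<in> E" "(a, c) \<in> E" and abc: "{a, b, c} = {x, y, z}"
      and PQ': "W = A \<union> B" "A \<inter> B = {}" "E \<inter> W \<times> W = A \<times> B \<union> B \<times> A"
        "card W = card A + card B" "card A * card B = card W * card W div 4"
      and sides: "E `` {a} \<inter> W \<subseteq> A" "E `` {b} \<inter> W \<subseteq> A" "E `` {c} \<inter> W \<subseteq> B"
      and sum: "card (E `` {a} \<inter> W \<inter> (E `` {b} \<inter> W)) + card (E `` {b} \<inter> W \<inter> (E `` {c} \<inter> W))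
        + card (E `` {a} \<inter> W \<inter> (E `` {c} \<inter> W)) + 1 = card (triangle_sets E)"
    for a b c A B
  proof -
    have finA: "finite A" "finite B" using finW PQ'(1) by simp_all
    have W': "V - {a, b, c} = A \<union> B" using PQ'(1) abc by (simp add: W_def)
    have cover': "A \<union> B \<subseteq> E `` {a} \<union> E `` {b} \<union> E `` {c}"
    proof -
      have "E `` {a, b, c} = E `` {x, y, z}" by (simp only: abc)
      then show ?thesis using cover PQ'(1) by blast
    qed
    define C where "C = insert c (E `` {a} \<inter> E `` {b} \<inter> A)"
    have D: "defective_bipartite V E a b C (A - E `` {b}) (A - E `` {a}) B"
      unfolding C_def
      using defective_bipartite_from_triangle[OF G ab W' PQ'(2)] PQ'(3) sides cover'
      unfolding PQ'(1) by blast
    have "E `` {b} \<inter> W \<inter> (E `` {c} \<inter> W) = {}" "E `` {a} \<inter> W \<inter> (E `` {c} \<inter> W) = {}"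
      using sides PQ'(2) by blast+
    then have s: "card (E `` {a} \<inter> W \<inter> (E `` {b} \<inter> W)) + 1 = card (triangle_sets E)"
      using sum by (metis add_0_right card.empty)
    have "E `` {a} \<inter> W \<inter> (E `` {b} \<inter> W) = E `` {a} \<inter> E `` {b} \<inter> A"
      using sides PQ'(1) by blast
    moreover have "c \<notin> A" using W' by blast
    ultimately have cC: "card C = card (triangle_sets E)"
      using s finA by (simp add: C_def)
    have "A = (E `` {a} \<inter> E `` {b} \<inter> A) \<union> ((A - E `` {b}) \<union> (A - E `` {a}))" by blast
    also have "card \<dots> = card (E `` {a} \<inter> E `` {b} \<inter> A) + card ((A - E `` {b}) \<union> (A - E `` {a}))"
      using finA by (intro card_Un_disjoint) auto
    also have "card ((A - E `` {b}) \<union> (A - E `` {a})) = card (A - E `` {b}) + card (A - E `` {a})"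
    proof (intro card_Un_disjoint)
      show "(A - E `` {b}) \<inter> (A - E `` {a}) = {}"
        using cover' sides(3) PQ'(1,2) by blast
    qed (use finA in auto)
    finally have "card A = card (E `` {a} \<inter> E `` {b} \<inter> A) + (card (A - E `` {b}) + card (A - E `` {a}))" .
    moreover have "card (E `` {a} \<inter> E `` {b} \<inter> A) + 1 = card C"
      using \<open>c \<notin> A\<close> finA by (simp add: C_def)
    ultimately have cA: "card C + card (A - E `` {b}) + card (A - E `` {a}) = card A + 1"
      by simp
    show thesis
    proof (rule result[OF D cC])
      show "card C + card (A - E `` {b}) + card (A - E `` {a}) + card B + 2 = card V"
        using cA PQ'(4) cW six by linarith
      show "(card C + card (A - E `` {b}) + card (A - E `` {a}) - 1) * card B
          = (card V - 3) * (card V - 3) div 4"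
        using cA PQ'(5) cW by simp
    qed
  qed
  have PQ2: "W = Q \<union> P" "Q \<inter> P = {}" "E \<inter> W \<times> W = Q \<times> P \<union> P \<times> Q"
    "card W = card Q + card P" "card Q * card P = card W * card W div 4"
    using PQ by (auto simp: mult.commute)
  have sym: "(v, u) \<in> E" if "(u, v) \<in> E" for u v by (rule simple_graphD(4)[OF G that])
  have perm: "{x, z, y} = {x, y, z}" "{y, z, x} = {x, y, z}" by auto
  let ?d = "\<lambda>u v. card (E `` {u} \<inter> W \<inter> (E `` {v} \<inter> W))"
  have dsym: "?d u v = ?d v u" for u v by (simp add: Int_commute)
  have sums: "?d x y + ?d y z + ?d x z + 1 = card (triangle_sets E)"
    "?d x z + ?d z y + ?d x y + 1 = card (triangle_sets E)"
    "?d y z + ?d z x + ?d y x + 1 = card (triangle_sets E)"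
    using counts(4) dsym[of z y] dsym[of z x] dsym[of y x] by linarith+
  have notall: "\<not> (E `` {x} \<inter> W \<subseteq> S \<and> E `` {y} \<inter> W \<subseteq> S \<and> E `` {z} \<inter> W \<subseteq> S)" if "S = P \<or> S = Q" for S
    using cover PQ(1,2) nonempty that by blast
  note f1 = finish[OF xyz refl _ _ _ _ _ _ _ _ sums(1)]
  note f2 = finish[OF xyz(3) sym[OF xyz(2)] xyz(1) perm(1) _ _ _ _ _ _ _ _ sums(2)]
  note f3 = finish[OF xyz(2) sym[OF xyz(3)] sym[OF xyz(1)] perm(2) _ _ _ _ _ _ _ _ sums(3)]
  show thesis
    using indep[of x] indep[of y] indep[of z] notall[of P] notall[of Q]
      f1[OF PQ] f1[OF PQ2] f2[OF PQ] f2[OF PQ2] f3[OF PQ] f3[OF PQ2]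
    by blast
qed

section \<open>A spectral lower bound for the number of triangles\<close>

text \<open>
  For a matrix \<open>B\<close> with Frobenius norm \<open>N\<close> this is \<open>\<bar>tr (B\<^sup>3)\<bar> \<le> N\<^sup>3\<close>: by Cauchy-Schwarz for the Frobenius
  inner product the trace is at most \<open>N\<close> times the norm of \<open>B\<^sup>2\<close>, and that norm is at most \<open>N\<^sup>2\<close>.
\<close>

lemma trace_cube_le_frobenius:
  fixes V :: "'a set" and B :: "'a \<Rightarrow> 'a \<Rightarrow> real"
  defines "F \<equiv> \<Sum>u\<in>V. \<Sum>v\<in>V. (B u v)\<^sup>2"
  shows "\<bar>\<Sum>u\<in>V. \<Sum>v\<in>V. \<Sum>w\<in>V. B u v * B v w * B w u\<bar> \<le> F * sqrt F"
proof -
  define C where "C u w = (\<Sum>v\<in>V. B u v * B v w)" for u w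
  have F0: "0 \<le> F" by (simp add: F_def sum_nonneg)
  have Fswap: "(\<Sum>w\<in>V. \<Sum>v\<in>V. (B v w)\<^sup>2) = F"
    unfolding F_def by (rule sum.swap)
  have "(\<Sum>u\<in>V. \<Sum>w\<in>V. (C u w)\<^sup>2) \<le> (\<Sum>u\<in>V. \<Sum>w\<in>V. (\<Sum>v\<in>V. (B u v)\<^sup>2) * (\<Sum>v\<in>V. (B v w)\<^sup>2))"
    unfolding C_def by (intro sum_mono Cauchy_Schwarz_ineq_sum)
  also have "\<dots> = (\<Sum>u\<in>V. \<Sum>v\<in>V. (B u v)\<^sup>2) * (\<Sum>w\<in>V. \<Sum>v\<in>V. (B v w)\<^sup>2)"
    by (rule sum_product[symmetric])
  also have "\<dots> = F * F"
    unfolding Fswap by (simp add: F_def)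
  finally have CF: "(\<Sum>u\<in>V. \<Sum>w\<in>V. (C u w)\<^sup>2) \<le> F * F" .
  have "(\<Sum>u\<in>V. \<Sum>v\<in>V. \<Sum>w\<in>V. B u v * B v w * B w u) = (\<Sum>u\<in>V. \<Sum>w\<in>V. \<Sum>v\<in>V. B u v * B v w * B w u)"
    by (intro sum.cong refl sum.swap)
  also have "\<dots> = (\<Sum>u\<in>V. \<Sum>w\<in>V. C u w * B w u)"
    by (simp add: C_def sum_distrib_right)
  also have "\<dots> = (\<Sum>(u, w)\<in>V \<times> V. C u w * B w u)"
    by (simp add: sum.cartesian_product)
  finally have tr: "(\<Sum>u\<in>V. \<Sum>v\<in>V. \<Sum>w\<in>V. B u v * B v w * B w u) =
      (\<Sum>p\<in>V \<times> V. C (fst p) (snd p) * B (snd p) (fst p))"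
    by (simp add: case_prod_unfold)
  have "(\<Sum>p\<in>V \<times> V. C (fst p) (snd p) * B (snd p) (fst p))\<^sup>2 \<le>
      (\<Sum>p\<in>V \<times> V. (C (fst p) (snd p))\<^sup>2) * (\<Sum>p\<in>V \<times> V. (B (snd p) (fst p))\<^sup>2)"
    by (rule Cauchy_Schwarz_ineq_sum)
  also have "(\<Sum>p\<in>V \<times> V. (C (fst p) (snd p))\<^sup>2) = (\<Sum>u\<in>V. \<Sum>w\<in>V. (C u w)\<^sup>2)"
    by (simp add: sum.cartesian_product case_prod_unfold)
  also have "(\<Sum>p\<in>V \<times> V. (B (snd p) (fst p))\<^sup>2) = F"
    unfolding Fswap[symmetric] by (simp add: sum.cartesian_product case_prod_unfold)
  also have "(\<Sum>u\<in>V. \<Sum>w\<in>V. (C u w)\<^sup>2) * F \<le> F * F * F"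
    using CF F0 by (rule mult_right_mono)
  also have "\<dots> = (F * sqrt F)\<^sup>2"
    using F0 by (simp add: power2_eq_square algebra_simps real_sqrt_mult_self)
  finally show ?thesis
    unfolding tr using F0 by (metis abs_le_square_iff abs_of_nonneg mult_nonneg_nonneg real_sqrt_ge_zero)
qed

text \<open>
  Subtracting \<open>\<rho> g g\<^sup>T\<close>, with \<open>\<rho>\<close> the Rayleigh quotient of the unit vector \<open>g\<close>, plays the role of
  removing the largest eigenvalue without \<open>g\<close> being an eigenvector. For an eigenvector the
  last two terms of the second formula add up to \<open>- \<rho>\<^sup>3\<close>.
\<close>

lemma trace_cube_deflated:
  fixes V :: "'a set" and A :: "'a \<Rightarrow> 'a \<Rightarrow> real" and g :: "'a \<Rightarrow> real"
  assumes sym: "\<And>u v. u \<in> V \<Longrightarrow> v \<in> V \<Longrightarrow> A u v = A v u"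
    and unit: "(\<Sum>v\<in>V. (g v)\<^sup>2) = 1"
  defines "h \<equiv> \<lambda>u. \<Sum>v\<in>V. A u v * g v"
  assumes rho: "\<rho> = (\<Sum>u\<in>V. g u * h u)"
  shows "(\<Sum>u\<in>V. \<Sum>v\<in>V. (A u v - \<rho> * g u * g v)\<^sup>2) = (\<Sum>u\<in>V. \<Sum>v\<in>V. (A u v)\<^sup>2) - \<rho>\<^sup>2"
    and "(\<Sum>u\<in>V. \<Sum>v\<in>V. \<Sum>w\<in>V.
        (A u v - \<rho> * g u * g v) * (A v w - \<rho> * g v * g w) * (A w u - \<rho> * g w * g u)) =
      (\<Sum>u\<in>V. \<Sum>v\<in>V. \<Sum>w\<in>V. A u v * A v w * A w u) - 3 * \<rho> * (\<Sum>v\<in>V. (h v)\<^sup>2) + 2 * \<rho> ^ 3"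
proof -
  have unit': "(\<Sum>v\<in>V. g v * g v) = 1" using unit by (simp add: power2_eq_square)
  have right: "(\<Sum>v\<in>V. A u v * (g v * c)) = h u * c" for u c
    by (simp add: h_def sum_distrib_right mult.assoc)
  have left: "(\<Sum>v\<in>V. A v u * (g v * c)) = h u * c" if "u \<in> V" for u c
  proof -
    have "(\<Sum>v\<in>V. A v u * (g v * c)) = (\<Sum>v\<in>V. A u v * (g v * c))"
      using that by (intro sum.cong) (auto simp: sym)
    then show ?thesis by (simp add: right)
  qed
  have gh: "(\<Sum>u\<in>V. g u * (h u * c)) = \<rho> * c" for c
    by (simp add: rho sum_distrib_right mult.assoc)
  have gg: "(\<Sum>u\<in>V. g u * (g u * c)) = c" for c
    using unit' by (simp add: sum_distrib_right[symmetric] mult.assoc[symmetric])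
  have "(\<Sum>u\<in>V. \<Sum>v\<in>V. (A u v - \<rho> * g u * g v)\<^sup>2) =
      (\<Sum>u\<in>V. \<Sum>v\<in>V. (A u v)\<^sup>2 - 2 * (A u v * (g v * (g u * \<rho>))) + g v * (g v * (g u * (g u * \<rho>\<^sup>2))))"
    by (intro sum.cong refl) (simp add: power2_eq_square algebra_simps)
  also have "\<dots> = (\<Sum>u\<in>V. \<Sum>v\<in>V. (A u v)\<^sup>2) - 2 * (\<Sum>u\<in>V. g u * (h u * \<rho>)) + (\<Sum>u\<in>V. g u * (g u * \<rho>\<^sup>2))"
    by (simp add: sum.distrib sum_subtractf sum_distrib_left[symmetric] right gg)
       (simp add: mult.left_commute)
  finally show "(\<Sum>u\<in>V. \<Sum>v\<in>V. (A u v - \<rho> * g u * g v)\<^sup>2) = (\<Sum>u\<in>V. \<Sum>v\<in>V. (A u v)\<^sup>2) - \<rho>\<^sup>2"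
    by (simp add: gh gg power2_eq_square)
  \<comment> \<open>Each monomial is written so that the sum over its innermost variable can be evaluated first.\<close>
  have expand: "(A u v - \<rho> * g u * g v) * (A v w - \<rho> * g v * g w) * (A w u - \<rho> * g w * g u) =
      A u v * A v w * A w u
      - A v w * (g w * (A u v * (g u * \<rho>)))
      - A w u * (g w * (A u v * (g v * \<rho>)))
      - A w u * (g u * (A v w * (g v * \<rho>)))
      + g w * (g w * (A u v * (g v * (g u * \<rho>\<^sup>2))))
      + A v w * (g w * (g v * (g u * (g u * \<rho>\<^sup>2))))
      + A w u * (g w * (g u * (g v * (g v * \<rho>\<^sup>2))))
      - g w * (g w * (g v * (g v * (g u * (g u * \<rho> ^ 3)))))" for u v w
    by (simp add: algebra_simps power2_eq_square power3_eq_cube)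
  let ?N = "\<Sum>v\<in>V. (h v)\<^sup>2"
  have t1: "(\<Sum>u\<in>V. \<Sum>v\<in>V. \<Sum>w\<in>V. A v w * (g w * (A u v * (g u * \<rho>)))) = \<rho> * ?N"
  proof -
    have "(\<Sum>u\<in>V. \<Sum>v\<in>V. \<Sum>w\<in>V. A v w * (g w * (A u v * (g u * \<rho>)))) =
        (\<Sum>u\<in>V. \<Sum>v\<in>V. A u v * (g u * (\<rho> * h v)))"
      by (simp add: right) (simp add: mult_ac)
    also have "\<dots> = (\<Sum>v\<in>V. \<Sum>u\<in>V. A u v * (g u * (\<rho> * h v)))" by (rule sum.swap)
    also have "\<dots> = \<rho> * ?N"
      by (simp add: left) (simp add: sum_distrib_left power2_eq_square mult_ac)
    finally show ?thesis .
  qed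
  have t2: "(\<Sum>u\<in>V. \<Sum>v\<in>V. \<Sum>w\<in>V. A w u * (g w * (A u v * (g v * \<rho>)))) = \<rho> * ?N"
  proof -
    have "(\<Sum>u\<in>V. \<Sum>v\<in>V. \<Sum>w\<in>V. A w u * (g w * (A u v * (g v * \<rho>)))) =
        (\<Sum>u\<in>V. \<Sum>v\<in>V. A u v * (g v * (\<rho> * h u)))"
      by (simp add: left) (simp add: mult_ac)
    also have "\<dots> = \<rho> * ?N"
      by (simp add: right) (simp add: sum_distrib_left power2_eq_square mult_ac)
    finally show ?thesis .
  qed
  have t3: "(\<Sum>u\<in>V. \<Sum>v\<in>V. \<Sum>w\<in>V. A w u * (g u * (A v w * (g v * \<rho>)))) = \<rho> * ?N"
  proof -
    have "(\<Sum>u\<in>V. \<Sum>v\<in>V. \<Sum>w\<in>V. A w u * (g u * (A v w * (g v * \<rho>)))) =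
        (\<Sum>u\<in>V. \<Sum>w\<in>V. \<Sum>v\<in>V. A v w * (g v * (A w u * (g u * \<rho>))))"
    proof (rule sum.cong[OF refl])
      fix u
      have "(\<Sum>v\<in>V. \<Sum>w\<in>V. A w u * (g u * (A v w * (g v * \<rho>)))) =
          (\<Sum>w\<in>V. \<Sum>v\<in>V. A w u * (g u * (A v w * (g v * \<rho>))))"
        by (rule sum.swap)
      then show "(\<Sum>v\<in>V. \<Sum>w\<in>V. A w u * (g u * (A v w * (g v * \<rho>)))) =
          (\<Sum>w\<in>V. \<Sum>v\<in>V. A v w * (g v * (A w u * (g u * \<rho>))))"
        by (simp add: mult_ac)
    qed
    also have "\<dots> = (\<Sum>u\<in>V. \<Sum>w\<in>V. A w u * (g u * (\<rho> * h w)))"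
      by (simp add: left) (simp add: mult_ac)
    also have "\<dots> = (\<Sum>w\<in>V. \<Sum>u\<in>V. A w u * (g u * (\<rho> * h w)))" by (rule sum.swap)
    also have "\<dots> = \<rho> * ?N"
      by (simp add: right) (simp add: sum_distrib_left power2_eq_square mult_ac)
    finally show ?thesis .
  qed
  have ghc: "(\<Sum>u\<in>V. h u * (g u * c)) = \<rho> * c" for c
    using gh[of c] by (simp add: mult.left_commute)
  have t4: "(\<Sum>u\<in>V. \<Sum>v\<in>V. \<Sum>w\<in>V. g w * (g w * (A u v * (g v * (g u * \<rho>\<^sup>2))))) = \<rho> ^ 3"
    by (simp add: gg right ghc) (simp add: power2_eq_square power3_eq_cube)
  have t5: "(\<Sum>u\<in>V. \<Sum>v\<in>V. \<Sum>w\<in>V. A v w * (g w * (g v * (g u * (g u * \<rho>\<^sup>2))))) = \<rho> ^ 3"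
    by (simp add: right ghc) (simp add: sum_distrib_left[symmetric] gg power2_eq_square power3_eq_cube)
  have t6: "(\<Sum>u\<in>V. \<Sum>v\<in>V. \<Sum>w\<in>V. A w u * (g w * (g u * (g v * (g v * \<rho>\<^sup>2))))) = \<rho> ^ 3"
  proof -
    have "(\<Sum>u\<in>V. \<Sum>v\<in>V. \<Sum>w\<in>V. A w u * (g w * (g u * (g v * (g v * \<rho>\<^sup>2))))) =
      (\<Sum>u\<in>V. \<Sum>v\<in>V. g v * (g v * (h u * (g u * \<rho>\<^sup>2))))"
      by (simp add: left) (simp add: mult_ac)
    also have "\<dots> = \<rho> ^ 3"
      by (simp add: gg ghc power2_eq_square power3_eq_cube)
    finally show ?thesis .
  qed
  have t7: "(\<Sum>u\<in>V. \<Sum>v\<in>V. \<Sum>w\<in>V. g w * (g w * (g v * (g v * (g u * (g u * \<rho> ^ 3)))))) = \<rho> ^ 3"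
    by (simp add: gg)
  show "(\<Sum>u\<in>V. \<Sum>v\<in>V. \<Sum>w\<in>V.
        (A u v - \<rho> * g u * g v) * (A v w - \<rho> * g v * g w) * (A w u - \<rho> * g w * g u)) =
      (\<Sum>u\<in>V. \<Sum>v\<in>V. \<Sum>w\<in>V. A u v * A v w * A w u) - 3 * \<rho> * ?N + 2 * \<rho> ^ 3"
    unfolding expand sum.distrib sum_subtractf t1 t2 t3 t4 t5 t6 t7 by simp
qed

text \<open>The trace of the cube of the adjacency matrix counts each triangle once for each ordering of its vertices.\<close>

lemma card_ordered_triangles:
  assumes G: "simple_graph V E"
  shows "card {(u, v, w). (u, v) \<in> E \<and> (v, w) \<in> E \<and> (w, u) \<in> E} = 6 * card (triangle_sets E)"
proof -
  let ?O = "{(u, v, w). (u, v) \<in> E \<and> (v, w) \<in> E \<and> (w, u) \<in> E}"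
  define f :: "'a \<times> 'a \<times> 'a \<Rightarrow> 'a set" where "f = (\<lambda>(u, v, w). {u, v, w})"
  have "?O \<subseteq> V \<times> V \<times> V" using simple_graphD(6)[OF G] by auto
  then have finO: "finite ?O" using simple_graphD(1)[OF G] by (meson finite_SigmaI finite_subset)
  have img: "f ` ?O \<subseteq> triangle_sets E"
    using triangle_setI[OF G] simple_graphD(4)[OF G] by (auto simp: f_def)
  have fiber: "card {p \<in> ?O. f p = T} = 6" if T: "T \<in> triangle_sets E" for T
  proof -
    obtain x y z where Txyz: "T = {x, y, z}" and d: "x \<noteq> y" "y \<noteq> z" "x \<noteq> z"
      and e: "(x, y) \<in> E" "(y, z) \<in> E" "(x, z) \<in> E" using triangle_setE[OF T] by metis
    have e': "(y, x) \<in> E" "(z, y) \<in> E" "(z, x) \<in> E" using e simple_graphD(4)[OF G] by auto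
    have "{p \<in> ?O. f p = T} = {(x, y, z), (x, z, y), (y, x, z), (y, z, x), (z, x, y), (z, y, x)}"
    proof
      show "{p \<in> ?O. f p = T} \<subseteq> {(x, y, z), (x, z, y), (y, x, z), (y, z, x), (z, x, y), (z, y, x)}"
      proof
        fix p assume p: "p \<in> {p \<in> ?O. f p = T}"
        obtain u v w where uvw: "p = (u, v, w)" by (cases p)
        have "u \<noteq> v" "v \<noteq> w" "w \<noteq> u" "{u, v, w} = {x, y, z}"
          using p simple_graphD(5)[OF G] by (auto simp: uvw f_def Txyz)
        then have "u \<in> {x, y, z}" "v \<in> {x, y, z}" "w \<in> {x, y, z}" "u \<noteq> v" "v \<noteq> w" "w \<noteq> u" by blast+
        then show "p \<in> {(x, y, z), (x, z, y), (y, x, z), (y, z, x), (z, x, y), (z, y, x)}"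
          unfolding uvw by auto
      qed
    qed (use e e' in \<open>auto simp: f_def Txyz\<close>)
    then show ?thesis using d by (simp add: card_insert_if)
  qed
  have "card ?O = (\<Sum>T\<in>triangle_sets E. \<Sum>p\<in>{p \<in> ?O. f p = T}. 1)"
    using sum.group[OF finO finite_triangle_sets[OF G] img, of "\<lambda>_. 1::nat"] by simp
  also have "\<dots> = (\<Sum>T\<in>triangle_sets E. 6)"
    using fiber by (intro sum.cong) simp_all
  finally show ?thesis by simp
qed

lemma sum_adjacency:
  fixes g :: "'a \<Rightarrow> real"
  assumes "simple_graph V E"
  shows "(\<Sum>v\<in>V. of_bool ((u, v) \<in> E) * g v) = (\<Sum>v\<in>E `` {u}. g v)"
proof -
  have "E `` {u} = V \<inter> {v. (u, v) \<in> E}" using simple_graphD(7)[OF assms] by auto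
  then show ?thesis
    using simple_graphD(1)[OF assms] by simp
qed

text \<open>
  \<open>\<rho>\<close> is the Rayleigh quotient of \<open>g\<close>; it is at least \<open>\<mu>\<close> because \<open>\<mu> g \<le> A g\<close> and \<open>g\<close> is nonnegative.
  Cauchy-Schwarz gives \<open>\<parallel>A g\<parallel> \<ge> \<rho>\<close> for normalised \<open>g\<close>, so the cube of the deflated matrix has trace
  at most \<open>6 t - \<rho>\<^sup>3\<close>, while its squared Frobenius norm is \<open>2 m - \<rho>\<^sup>2\<close>.
\<close>

lemma spectral_triangle_inequality:
  fixes g :: "'a \<Rightarrow> real"
  assumes G: "simple_graph V E"
    and g: "\<And>u. u \<in> V \<Longrightarrow> 0 \<le> g u" "\<exists>u\<in>V. g u \<noteq> 0"
    and sub: "\<And>u. u \<in> V \<Longrightarrow> \<mu> * g u \<le> (\<Sum>v\<in>E `` {u}. g v)"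
    and l: "0 \<le> \<mu>"
  obtains \<rho> where "\<mu> \<le> \<rho>" "\<rho>\<^sup>2 \<le> real (card E)"
    "\<rho> ^ 3 \<le> 6 * real (card (triangle_sets E)) + (real (card E) - \<rho>\<^sup>2) * sqrt (real (card E) - \<rho>\<^sup>2)"
proof -
  note fin = simple_graphD(1,3)[OF G]
  define s where "s = (\<Sum>u\<in>V. (g u)\<^sup>2)"
  obtain u0 where u0: "u0 \<in> V" "g u0 \<noteq> 0" using g(2) by auto
  have "0 < (g u0)\<^sup>2" using u0 by simp
  also have "\<dots> \<le> s" unfolding s_def using fin u0 by (intro member_le_sum) auto
  finally have s: "0 < s" .
  define k where "k u = g u / sqrt s" for u
  define A :: "'a \<Rightarrow> 'a \<Rightarrow> real" where "A u v = of_bool ((u, v) \<in> E)" for u v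
  have Asym: "A u v = A v u" for u v
    using simple_graphD(4)[OF G, of u v] simple_graphD(4)[OF G, of v u] by (auto simp: A_def)
  define h where "h u = (\<Sum>v\<in>V. A u v * k v)" for u
  define \<rho> where "\<rho> = (\<Sum>u\<in>V. k u * h u)"
  have unit: "(\<Sum>v\<in>V. (k v)\<^sup>2) = 1"
    using s by (simp add: k_def power_divide sum_divide_distrib[symmetric] s_def[symmetric])
  have ksub: "\<mu> * k u \<le> h u" if "u \<in> V" for u
  proof -
    have "h u = (\<Sum>v\<in>E `` {u}. g v) / sqrt s"
      unfolding h_def A_def sum_adjacency[OF G] by (simp add: k_def sum_divide_distrib)
    then show ?thesis using sub[OF that] s by (simp add: k_def divide_right_mono)
  qed
  have k0: "0 \<le> k u" if "u \<in> V" for u using g(1)[OF that] s by (simp add: k_def)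
  have "\<mu> = (\<Sum>u\<in>V. k u * (\<mu> * k u))"
    using unit by (simp add: power2_eq_square mult.left_commute sum_distrib_left[symmetric])
  also have "\<dots> \<le> \<rho>"
    unfolding \<rho>_def using k0 ksub by (intro sum_mono mult_left_mono) auto
  finally have lr: "\<mu> \<le> \<rho>" .
  then have r0: "0 \<le> \<rho>" using l by simp
  have cardE: "(\<Sum>u\<in>V. \<Sum>v\<in>V. (A u v)\<^sup>2) = real (card E)"
  proof -
    have "(\<Sum>u\<in>V. \<Sum>v\<in>V. (A u v)\<^sup>2) = (\<Sum>u\<in>V. \<Sum>v\<in>V. of_bool ((u, v) \<in> E) * 1)"
      unfolding A_def by (intro sum.cong refl) simp
    also have "\<dots> = (\<Sum>u\<in>V. \<Sum>v\<in>E `` {u}. 1)"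
      by (simp only: sum_adjacency[OF G])
    also have "\<dots> = real (\<Sum>u\<in>V. card (E `` {u}))" by simp
    also have "(\<Sum>u\<in>V. card (E `` {u})) = card (Sigma V (\<lambda>u. E `` {u}))"
      using fin by (simp add: finite_Image)
    also have "Sigma V (\<lambda>u. E `` {u}) = E" using simple_graphD(6)[OF G] by auto
    finally show ?thesis .
  qed
  have tri: "(\<Sum>u\<in>V. \<Sum>v\<in>V. \<Sum>w\<in>V. A u v * A v w * A w u) = 6 * real (card (triangle_sets E))"
  proof -
    let ?O = "{(u, v, w). (u, v) \<in> E \<and> (v, w) \<in> E \<and> (w, u) \<in> E}"
    have O: "?O \<subseteq> V \<times> V \<times> V" using simple_graphD(6)[OF G] by auto
    have "(\<Sum>u\<in>V. \<Sum>v\<in>V. \<Sum>w\<in>V. A u v * A v w * A w u) =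
        (\<Sum>(u, v, w)\<in>V \<times> V \<times> V. A u v * A v w * A w u)"
      by (simp add: sum.cartesian_product)
    also have "\<dots> = (\<Sum>p\<in>V \<times> V \<times> V. of_bool (p \<in> ?O))"
      by (intro sum.cong) (auto simp: A_def)
    also have "\<dots> = real (card ((V \<times> V \<times> V) \<inter> ?O))"
      using fin by (simp add: sum_of_bool_eq)
    also have "(V \<times> V \<times> V) \<inter> ?O = ?O" using O by blast
    finally show ?thesis using card_ordered_triangles[OF G] by simp
  qed
  let ?F = "real (card E) - \<rho>\<^sup>2"
  note defl = trace_cube_deflated[where V = V and A = A and g = k and \<rho> = \<rho>, OF Asym unit, folded h_def, OF \<rho>_def]
  have F: "(\<Sum>u\<in>V. \<Sum>v\<in>V. (A u v - \<rho> * k u * k v)\<^sup>2) = ?F"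
    unfolding defl(1) cardE ..
  have F0: "0 \<le> ?F" unfolding F[symmetric] by (intro sum_nonneg) simp
  have "\<rho>\<^sup>2 \<le> (\<Sum>u\<in>V. (k u)\<^sup>2) * (\<Sum>u\<in>V. (h u)\<^sup>2)"
    unfolding \<rho>_def by (rule Cauchy_Schwarz_ineq_sum)
  then have "\<rho> * \<rho>\<^sup>2 \<le> \<rho> * (\<Sum>u\<in>V. (h u)\<^sup>2)"
    using unit r0 by (intro mult_left_mono) simp_all
  then have N: "3 * \<rho> ^ 3 \<le> 3 * \<rho> * (\<Sum>u\<in>V. (h u)\<^sup>2)"
    by (simp add: power2_eq_square power3_eq_cube)
  have "\<bar>6 * real (card (triangle_sets E)) - 3 * \<rho> * (\<Sum>v\<in>V. (h v)\<^sup>2) + 2 * \<rho> ^ 3\<bar> \<le> ?F * sqrt ?F"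
    using trace_cube_le_frobenius[where V = V and B = "\<lambda>u v. A u v - \<rho> * k u * k v"]
    unfolding F defl(2) tri .
  then have "\<rho> ^ 3 \<le> 6 * real (card (triangle_sets E)) + ?F * sqrt ?F"
    using N by linarith
  then show ?thesis using that lr F0 by simp
qed

section \<open>Numerical consequences of the spectral bound\<close>

text \<open>
  With \<open>b\<^sup>2 = E - \<rho>\<^sup>2\<close> the hypotheses say \<open>6 t \<ge> \<rho>\<^sup>3 - b\<^sup>3\<close> and \<open>\<rho>\<^sup>2 - b\<^sup>2 \<ge> 4\<close>. If \<open>b\<close> is close to \<open>\<rho>\<close>, then
  \<open>\<rho>\<^sup>3 - b\<^sup>3 \<ge> 3/4 (\<rho>\<^sup>2 - b\<^sup>2) (\<rho> + b)\<close> is enough; if \<open>b < f - 2\<close>, monotonicity is.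
\<close>

lemma triangle_count_ge_of_spectral_gap:
  fixes \<rho> E t :: real and f :: nat
  assumes "0 \<le> \<rho>" "\<rho>\<^sup>2 \<le> E" "\<rho> ^ 3 \<le> 6 * t + (E - \<rho>\<^sup>2) * sqrt (E - \<rho>\<^sup>2)"
    and "4 \<le> 2 * \<rho>\<^sup>2 - E" "real f \<le> \<rho>" "2 \<le> f"
  shows "real f - 1 \<le> t"
proof -
  define b where "b = sqrt (E - \<rho>\<^sup>2)"
  have b: "0 \<le> b" "b\<^sup>2 = E - \<rho>\<^sup>2" using assms(2) by (simp_all add: b_def)
  have cube: "\<rho> ^ 3 - b ^ 3 \<le> 6 * t"
    using assms(3) unfolding b(2)[symmetric] b_def[symmetric] using b(1)
    by (simp add: power2_eq_square power3_eq_cube)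
  have gap: "4 \<le> (\<rho> - b) * (\<rho> + b)"
    using assms(4) b(2) by (simp add: power2_eq_square algebra_simps)
  have rb: "b \<le> \<rho>"
  proof (rule ccontr)
    assume "\<not> b \<le> \<rho>"
    then have "(\<rho> - b) * (\<rho> + b) \<le> 0" using assms(1) b(1) by (intro mult_nonpos_nonneg) auto
    then show False using gap by simp
  qed
  show ?thesis
  proof (cases "real f - 2 \<le> b")
    case True
    have "3 * (\<rho> + b) = 3 / 4 * (4 * (\<rho> + b))" by simp
    also have "\<dots> \<le> 3 / 4 * ((\<rho> - b) * (\<rho> + b) * (\<rho> + b))"
      using gap assms(1) b(1) by (intro mult_left_mono mult_right_mono) auto
    also have "\<dots> \<le> 3 / 4 * ((\<rho> - b) * (\<rho> + b) * (\<rho> + b)) + (\<rho> - b) ^ 3 / 4"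
      using rb by simp
    also have "\<dots> = \<rho> ^ 3 - b ^ 3"
      by (simp add: power3_eq_cube field_simps)
    finally have "3 * (\<rho> + b) \<le> 6 * t" using cube by simp
    moreover have "2 * real f - 2 \<le> \<rho> + b" using True assms(5) by simp
    ultimately show ?thesis by simp
  next
    case False
    have "6 * (real f - 1) * 1 \<le> 6 * (real f - 1) * (real f - 1)"
      using assms(6) by (intro mult_left_mono) auto
    also have "\<dots> \<le> real f ^ 3 - (real f - 2) ^ 3"
      by (simp add: power3_eq_cube algebra_simps)
    also have "\<dots> \<le> \<rho> ^ 3 - b ^ 3"
      using assms(5) False b(1) by (intro diff_mono power_mono) auto
    also have "\<dots> \<le> 6 * t" by (rule cube)
    finally show ?thesis by simp
  qed
qed

lemma triangle_count_positive:
  fixes \<rho> E t :: real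
  assumes "0 \<le> \<rho>" "\<rho>\<^sup>2 \<le> E" "\<rho> ^ 3 \<le> 6 * t + (E - \<rho>\<^sup>2) * sqrt (E - \<rho>\<^sup>2)" "E < 2 * \<rho>\<^sup>2"
  shows "0 < t"
proof -
  define b where "b = sqrt (E - \<rho>\<^sup>2)"
  have b: "0 \<le> b" "b\<^sup>2 = E - \<rho>\<^sup>2" using assms(2) by (simp_all add: b_def)
  have "b\<^sup>2 < \<rho>\<^sup>2" using b(2) assms(4) by simp
  then have "b < \<rho>" using assms(1) by (rule power2_less_imp_less)
  then have "b ^ 3 < \<rho> ^ 3" using b(1) by (intro power_strict_mono) auto
  moreover have "\<rho> ^ 3 \<le> 6 * t + b ^ 3"
    using assms(3) unfolding b(2)[symmetric] b_def[symmetric] using b(1)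
    by (simp add: power2_eq_square power3_eq_cube)
  ultimately show ?thesis by linarith
qed

section \<open>Test vectors for the graphs attaining equality\<close>

text \<open>
  Evaluate \<open>g\<^sup>T A v\<close> in two ways: it is less than \<open>\<mu> g\<^sup>T v\<close> by the property of \<open>v\<close>, and at least that by the
  property of \<open>g\<close>, as \<open>A\<close> is symmetric.
\<close>

lemma no_subinvariant_of_test_vector:
  fixes g v :: "'a \<Rightarrow> real"
  assumes G: "simple_graph V E"
    and g: "\<And>u. u \<in> V \<Longrightarrow> 0 \<le> g u" "\<exists>u\<in>V. g u \<noteq> 0"
    and sub: "\<And>u. u \<in> V \<Longrightarrow> \<mu> * g u \<le> (\<Sum>w\<in>E `` {u}. g w)"
    and v0: "\<And>u. u \<in> V \<Longrightarrow> 0 \<le> v u"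
    and v: "\<And>u. u \<in> V \<Longrightarrow> (\<Sum>w\<in>E `` {u}. v w) < \<mu> * v u"
  shows False
proof -
  note fin = simple_graphD(1,3)[OF G]
  have "(\<Sum>u\<in>V. g u * (\<Sum>w\<in>E `` {u}. v w)) < (\<Sum>u\<in>V. g u * (\<mu> * v u))"
  proof (rule sum_strict_mono_ex1[OF fin(1)])
    show "\<forall>u\<in>V. g u * (\<Sum>w\<in>E `` {u}. v w) \<le> g u * (\<mu> * v u)"
      by (intro ballI mult_left_mono less_imp_le[OF v] g(1))
    obtain u where "u \<in> V" "g u \<noteq> 0" using g(2) by auto
    moreover from this have "0 < g u" using g(1)[of u] by simp
    ultimately show "\<exists>u\<in>V. g u * (\<Sum>w\<in>E `` {u}. v w) < g u * (\<mu> * v u)"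
      using v by (auto intro!: bexI[of _ u])
  qed
  also have "\<dots> = (\<Sum>u\<in>V. v u * (\<mu> * g u))" by (simp add: mult_ac)
  also have "\<dots> \<le> (\<Sum>u\<in>V. v u * (\<Sum>w\<in>E `` {u}. g w))"
    using v0 sub by (intro sum_mono mult_left_mono) auto
  also have "\<dots> = (\<Sum>u\<in>V. \<Sum>w\<in>V. v u * (of_bool ((u, w) \<in> E) * g w))"
    by (simp only: sum_adjacency[OF G, symmetric] sum_distrib_left)
  also have "\<dots> = (\<Sum>w\<in>V. \<Sum>u\<in>V. v u * (of_bool ((u, w) \<in> E) * g w))" by (rule sum.swap)
  also have "\<dots> = (\<Sum>w\<in>V. g w * (\<Sum>u\<in>V. of_bool ((w, u) \<in> E) * v u))"
    using simple_graphD(4)[OF G] by (auto simp: sum_distrib_left mult_ac intro!: sum.cong)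
  also have "\<dots> = (\<Sum>w\<in>V. g w * (\<Sum>u\<in>E `` {w}. v u))"
    by (simp only: sum_adjacency[OF G])
  finally show False by simp
qed

text \<open>
  The test vector takes the values \<open>ax\<close>, \<open>ay\<close>, \<open>aq\<close> on \<open>x\<close>, \<open>y\<close>, \<open>Q\<close>, and \<open>\<mu> * p\<close>, \<open>\<mu> * w'\<close>, \<open>\<mu> * w\<close> on
  \<open>C\<close>, \<open>X\<close>, \<open>Y\<close>. Scaling the second side by \<open>\<mu>\<close> turns the conditions there into
  conditions on \<open>\<mu>\<^sup>2 \<ge> K\<close>, so that the possibly irrational square root of \<open>K\<close> does not occur. Only the
  edge \<open>x y\<close>, which stays within a side, leaves a term with \<open>1 / \<mu>\<close>, which is at most \<open>e\<close>.
\<close>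

lemma defective_bipartite_no_subinvariant:
  fixes g :: "'a \<Rightarrow> real" and ax ay aq p w w' e K \<mu> :: real
  assumes G: "simple_graph V E" and D: "defective_bipartite V E x y C X Y Q"
    and g: "\<And>u. u \<in> V \<Longrightarrow> 0 \<le> g u" "\<exists>u\<in>V. g u \<noteq> 0"
    and sub: "\<And>u. u \<in> V \<Longrightarrow> \<mu> * g u \<le> (\<Sum>v\<in>E `` {u}. g v)"
    and l: "0 < \<mu>" "1 \<le> \<mu> * e" "K \<le> \<mu>\<^sup>2"
    and pos: "0 \<le> ax" "0 \<le> ay" "0 \<le> aq" "0 \<le> p" "0 \<le> w'" "0 \<le> w"
    and cx: "ay * e + real (card C) * p + real (card X) * w' < ax"
    and cy: "ax * e + real (card C) * p + real (card Y) * w < ay"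
    and cq: "real (card C) * p + real (card X) * w' + real (card Y) * w < aq"
    and cc: "ax + ay + real (card Q) * aq < K * p"
    and cX: "X \<noteq> {} \<Longrightarrow> ax + real (card Q) * aq < K * w'"
    and cY: "Y \<noteq> {} \<Longrightarrow> ay + real (card Q) * aq < K * w"
  shows False
proof -
  have V: "V = {x, y} \<union> Q \<union> (C \<union> X \<union> Y)" and xy: "x \<noteq> y" and xyQ0: "{x, y} \<inter> Q = {}"
    and sides: "({x, y} \<union> Q) \<inter> (C \<union> X \<union> Y) = {}"
    and CXY: "C \<inter> X = {}" "C \<inter> Y = {}" "X \<inter> Y = {}"
    and Nxy: "E `` {x} = {y} \<union> C \<union> X" "E `` {y} = {x} \<union> C \<union> Y"
    and NQ: "\<forall>u\<in>Q. E `` {u} = C \<union> X \<union> Y" and NC: "\<forall>u\<in>C. E `` {u} = {x, y} \<union> Q"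
    and NX: "\<forall>u\<in>X. E `` {u} = {x} \<union> Q" and NY: "\<forall>u\<in>Y. E `` {u} = {y} \<union> Q"
    using D unfolding defective_bipartite_def by - (elim conjE, assumption)+
  note N = Nxy NQ[THEN bspec] NC[THEN bspec] NX[THEN bspec] NY[THEN bspec]
  have xyQ: "x \<notin> Q" "y \<notin> Q" using xyQ0 by blast+
  have dis: "x \<notin> C \<union> X \<union> Y" "y \<notin> C \<union> X \<union> Y" "Q \<inter> C = {}" "Q \<inter> X = {}" "Q \<inter> Y = {}"
      "C \<inter> X = {}" "C \<inter> Y = {}" "X \<inter> Y = {}"
    using sides CXY by blast+
  have fin: "finite Q" "finite C" "finite X" "finite Y"
    using simple_graphD(1)[OF G] unfolding V by simp_all
  define v where "v u = (if u = x then ax else if u = y then ay else if u \<in> Q then aq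
    else if u \<in> C then \<mu> * p else if u \<in> X then \<mu> * w' else \<mu> * w)" for u
  have vx: "v x = ax" and vy: "v y = ay" using xy by (simp_all add: v_def)
  have vQ: "v u = aq" if "u \<in> Q" for u using that xyQ by (auto simp: v_def)
  have vC: "v u = \<mu> * p" if "u \<in> C" for u using that dis by (auto simp: v_def)
  have vX: "v u = \<mu> * w'" if "u \<in> X" for u using that dis by (auto simp: v_def)
  have vY: "v u = \<mu> * w" if "u \<in> Y" for u using that dis by (auto simp: v_def)
  have sQ: "sum v Q = real (card Q) * aq" using vQ by simp
  have sC: "sum v C = real (card C) * (\<mu> * p)" using vC by simp
  have sX: "sum v X = real (card X) * (\<mu> * w')" using vX by simp
  have sY: "sum v Y = real (card Y) * (\<mu> * w)" using vY by simp
  have scale: "a + \<mu> * b < \<mu> * c" if "0 \<le> a" "a * e + b < c" for a b c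
  proof -
    have "a * 1 \<le> a * (\<mu> * e)" using that(1) l(2) by (rule mult_left_mono[rotated])
    then have "a + \<mu> * b \<le> \<mu> * (a * e + b)" by (simp add: algebra_simps)
    also have "\<dots> < \<mu> * c" using that(2) l(1) by simp
    finally show ?thesis .
  qed
  have square: "a < \<mu> * (\<mu> * b)" if "0 \<le> b" "a < K * b" for a b
  proof -
    have "K * b \<le> \<mu>\<^sup>2 * b" using l(3) that(1) by (rule mult_right_mono)
    then show ?thesis using that(2) by (simp add: power2_eq_square mult.assoc)
  qed
  have test: "(\<Sum>w\<in>E `` {u}. v w) < \<mu> * v u" if u: "u \<in> V" for u
  proof -
    consider "u = x" | "u = y" | "u \<in> Q" | "u \<in> C" | "u \<in> X" | "u \<in> Y"
      using u unfolding V by blast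
    then show ?thesis
    proof cases
      case 1
      have "(\<Sum>w\<in>E `` {x}. v w) = ay + sum v C + sum v X"
        unfolding N using dis fin by (subst sum.union_disjoint; simp add: vy sum.union_disjoint)
      also have "\<dots> = ay + \<mu> * (real (card C) * p + real (card X) * w')"
        by (simp add: sC sX algebra_simps)
      finally show ?thesis using scale[OF pos(2)] cx 1 by (simp add: vx add.assoc)
    next
      case 2
      have "(\<Sum>w\<in>E `` {y}. v w) = ax + sum v C + sum v Y"
        unfolding N using dis fin by (subst sum.union_disjoint; simp add: vx sum.union_disjoint)
      also have "\<dots> = ax + \<mu> * (real (card C) * p + real (card Y) * w)"
        by (simp add: sC sY algebra_simps)
      finally show ?thesis using scale[OF pos(1)] cy 2 by (simp add: vy add.assoc)
    next
      case 3
      have "(\<Sum>w\<in>E `` {u}. v w) = sum v C + sum v X + sum v Y"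
        unfolding N(3)[OF 3] using dis fin by (simp add: sum.union_disjoint Int_Un_distrib2)
      also have "\<dots> = \<mu> * (real (card C) * p + real (card X) * w' + real (card Y) * w)"
        by (simp add: sC sX sY algebra_simps)
      finally show ?thesis using cq l(1) 3 by (simp add: vQ)
    next
      case 4
      have "(\<Sum>w\<in>E `` {u}. v w) = ax + ay + sum v Q"
        unfolding N(4)[OF 4] using xy xyQ fin by (simp add: vx vy)
      then show ?thesis using square[OF pos(4) cc] 4 by (simp add: vC sQ)
    next
      case 5
      have "(\<Sum>w\<in>E `` {u}. v w) = ax + sum v Q"
        unfolding N(5)[OF 5] using xyQ fin by (simp add: vx)
      then show ?thesis using square[OF pos(5) cX] 5 by (auto simp: vX sQ)
    next
      case 6
      have "(\<Sum>w\<in>E `` {u}. v w) = ay + sum v Q"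
        unfolding N(6)[OF 6] using xyQ fin by (simp add: vy)
      then show ?thesis using square[OF pos(6) cY] 6 by (auto simp: vY sQ)
    qed
  qed
  have "0 \<le> v u" for u using pos l(1) by (simp add: v_def)
  then show False
    using no_subinvariant_of_test_vector[OF G g sub _ test] by blast
qed

text \<open>
  The constants are polynomials in \<open>e = 1 / f\<close>. To first order they come from the Perron vector of
  the complete bipartite graph with the same sides: the value at a vertex is multiplied by \<open>1 + e\<close>
  or \<open>1 - e\<close> if the vertex has one neighbour more or less than there. The terms of higher order are
  chosen such that all inequalities are strict for every \<open>f \<ge> 3\<close>.
\<close>

lemma defective_bipartite_spectral_bound:
  fixes g :: "'a \<Rightarrow> real"
  assumes G: "simple_graph V E" and D: "defective_bipartite V E x y C X Y Q"
    and g: "\<And>u. u \<in> V \<Longrightarrow> 0 \<le> g u" "\<exists>u\<in>V. g u \<noteq> 0"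
    and sub: "\<And>u. u \<in> V \<Longrightarrow> \<mu> * g u \<le> (\<Sum>v\<in>E `` {u}. g v)"
    and f: "3 \<le> f" "card C + 2 = f" and l: "0 < \<mu>" "real K \<le> \<mu>\<^sup>2"
    and sizes: "card X + card Y = 2 \<and> card Q + 2 = f \<and> K = f * f
      \<or> card X + card Y = 2 \<and> card Q + 1 = f \<and> K = f * f + f
      \<or> card X + card Y = 1 \<and> card Q + 1 = f \<and> K = f * f"
  shows False
proof -
  define e where "e = 1 / real f"
  have fe: "real f * e = 1" using f by (simp add: e_def)
  have e: "0 < e" "3 * e \<le> 1" using f by (simp_all add: e_def field_simps)
  have F: "real (card C) = real f - 2" using f(2) by linarith
  have "real f \<le> \<mu>"
  proof (rule power2_le_imp_le)
    have "real (f * f) \<le> real K" using sizes by (intro of_nat_mono) auto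
    then show "(real f)\<^sup>2 \<le> \<mu>\<^sup>2" using l by (simp add: power2_eq_square)
  qed (use l in simp)
  then have le: "1 \<le> \<mu> * e" using fe e(1) by (metis less_eq_real_def mult_right_mono)
  have nf: "e * real f = 1" "e * (real f * t) = t" for t
    using fe by (simp_all add: mult.commute mult.assoc[symmetric])
  have e2: "0 < e" "3 * e \<le> 1" "0 < e * e" "3 * (e * e) \<le> e" "0 < e * (e * e)" "3 * (e * (e * e)) \<le> e * e"
    using e by auto
  note expand = algebra_simps power2_eq_square power3_eq_cube nf
  note no = defective_bipartite_no_subinvariant[OF G _ g sub l(1) le l(2)]
  have casts: "K = f * f \<Longrightarrow> real K = (real f)\<^sup>2" "K = f * f + f \<Longrightarrow> real K = (real f)\<^sup>2 + real f"
    "card Q + 2 = f \<Longrightarrow> real (card Q) = real f - 2" "card Q + 1 = f \<Longrightarrow> real (card Q) = real f - 1"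
    by (auto simp: power2_eq_square)
  have finXY: "finite X" "finite Y"
  proof -
    have "V = {x, y} \<union> Q \<union> (C \<union> X \<union> Y)"
      using D unfolding defective_bipartite_def by (elim conjE)
    then show "finite X" "finite Y" using simple_graphD(1)[OF G] by simp_all
  qed
  \<comment> \<open>Two missing edges at the same endpoint of the additional edge.\<close>
  have two: False
    if D': "defective_bipartite V E a b C X' Y' Q" and c: "card X' = 0" "card Y' = 2" "finite X'"
      and s: "card Q + 2 = f \<and> K = f * f \<or> card Q + 1 = f \<and> K = f * f + f"
    for a b X' Y'
  proof (rule no[OF D', of "1 - e + 2 * e\<^sup>2" "1 + e" 1 "e + e ^ 3" 0 "e - e\<^sup>2 + 2 * e ^ 3"])
    have q: "real (card Q) = real f - 2 \<and> real K = (real f)\<^sup>2 \<or>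
        real (card Q) = real f - 1 \<and> real K = (real f)\<^sup>2 + real f"
      using s casts by blast
    show "(1 + e) * e + real (card C) * (e + e ^ 3) + real (card X') * 0 < 1 - e + 2 * e\<^sup>2"
      using e2 by (simp add: F c expand)
    show "(1 - e + 2 * e\<^sup>2) * e + real (card C) * (e + e ^ 3) + real (card Y') * (e - e\<^sup>2 + 2 * e ^ 3) < 1 + e"
      using e2 by (simp add: F c expand)
    show "real (card C) * (e + e ^ 3) + real (card X') * 0 + real (card Y') * (e - e\<^sup>2 + 2 * e ^ 3) < 1"
      using e2 by (simp add: F c expand)
    show "1 - e + 2 * e\<^sup>2 + (1 + e) + real (card Q) * 1 < real K * (e + e ^ 3)"
      using q e2 by (auto simp: expand)
    show "1 + e + real (card Q) * 1 < real K * (e - e\<^sup>2 + 2 * e ^ 3)"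
      using q e2 by (auto simp: expand)
  qed (use e e2 c in \<open>auto simp: power2_eq_square power3_eq_cube\<close>)
  \<comment> \<open>One missing edge at each endpoint of the additional edge.\<close>
  have one: False
    if D': "defective_bipartite V E a b C X' Y' Q" and c: "card X' = 1" "card Y' = 1"
      and s: "card Q + 2 = f \<and> K = f * f \<or> card Q + 1 = f \<and> K = f * f + f"
    for a b X' Y'
  proof (rule no[OF D', of 1 1 1 "e + e ^ 3" "e - e\<^sup>2 + e ^ 3" "e - e\<^sup>2 + e ^ 3"])
    have q: "real (card Q) = real f - 2 \<and> real K = (real f)\<^sup>2 \<or>
        real (card Q) = real f - 1 \<and> real K = (real f)\<^sup>2 + real f"
      using s casts by blast
    show "1 * e + real (card C) * (e + e ^ 3) + real (card X') * (e - e\<^sup>2 + e ^ 3) < 1"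
      using e2 by (simp add: F c expand)
    show "1 * e + real (card C) * (e + e ^ 3) + real (card Y') * (e - e\<^sup>2 + e ^ 3) < 1"
      using e2 by (simp add: F c expand)
    show "real (card C) * (e + e ^ 3) + real (card X') * (e - e\<^sup>2 + e ^ 3) + real (card Y') * (e - e\<^sup>2 + e ^ 3) < 1"
      using e2 by (simp add: F c expand)
    show "1 + 1 + real (card Q) * 1 < real K * (e + e ^ 3)"
      using q e2 by (auto simp: expand)
    show "1 + real (card Q) * 1 < real K * (e - e\<^sup>2 + e ^ 3)" "1 + real (card Q) * 1 < real K * (e - e\<^sup>2 + e ^ 3)"
      using q e2 by (auto simp: expand)
  qed (use e e2 c in \<open>auto simp: power2_eq_square power3_eq_cube\<close>)
  \<comment> \<open>A single missing edge, with sides of sizes \<open>f + 1\<close> and \<open>f - 1\<close>.\<close>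
  have unbalanced: False
    if D': "defective_bipartite V E a b C X' Y' Q" and c: "card X' = 0" "card Y' = 1" "finite X'"
      and s: "card Q + 1 = f" "K = f * f"
    for a b X' Y'
  proof (rule no[OF D', of "1 - e\<^sup>2 / 2" "1 + e" "1 - 7 / 4 * e\<^sup>2" "e + e\<^sup>2" 0 e])
    have q: "real (card Q) = real f - 1" "real K = (real f)\<^sup>2"
      using s casts by blast+
    show "(1 + e) * e + real (card C) * (e + e\<^sup>2) + real (card X') * 0 < 1 - e\<^sup>2 / 2"
      using e2 by (simp add: F c expand)
    show "(1 - e\<^sup>2 / 2) * e + real (card C) * (e + e\<^sup>2) + real (card Y') * e < 1 + e"
      using e2 by (simp add: F c expand)
    show "real (card C) * (e + e\<^sup>2) + real (card X') * 0 + real (card Y') * e < 1 - 7 / 4 * e\<^sup>2"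
      using e2 by (simp add: F c expand)
    have fe2: "real f * e\<^sup>2 = e" "(real f)\<^sup>2 * e = real f" "(real f)\<^sup>2 * e\<^sup>2 = 1"
      by (simp_all add: expand)
    have rest: "real (card Q) * (1 - 7 / 4 * e\<^sup>2) = real f - 1 - 7 / 4 * (real f * e\<^sup>2) + 7 / 4 * e\<^sup>2"
      unfolding q by (simp add: field_simps)
    have sq: "0 < e\<^sup>2" "3 * e\<^sup>2 \<le> e" using e2 by (simp_all add: power2_eq_square)
    show "1 - e\<^sup>2 / 2 + (1 + e) + real (card Q) * (1 - 7 / 4 * e\<^sup>2) < real K * (e + e\<^sup>2)"
      unfolding rest q(2) distrib_left fe2 using sq e2(1) by linarith
    show "1 + e + real (card Q) * (1 - 7 / 4 * e\<^sup>2) < real K * e"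
      unfolding rest q(2) fe2 using sq e2(1) by linarith
  qed (use e e2 c in \<open>auto simp: power2_eq_square power3_eq_cube\<close>)
  note D' = defective_bipartite_swap[OF D]
  show False
  proof (cases "card X + card Y = 1")
    case True
    then have "card X = 0 \<and> card Y = 1 \<or> card Y = 0 \<and> card X = 1" by linarith
    moreover have "card Q + 1 = f" "K = f * f" using sizes True by auto
    ultimately show False using unbalanced[OF D] unbalanced[OF D'] finXY by blast
  next
    case False
    then have "card X + card Y = 2" and s: "card Q + 2 = f \<and> K = f * f \<or> card Q + 1 = f \<and> K = f * f + f"
      using sizes by auto
    then have "card X = 0 \<and> card Y = 2 \<or> card Y = 0 \<and> card X = 2 \<or> card X = 1 \<and> card Y = 1" by linarith
    then show False using two[OF D] two[OF D'] one[OF D] s finXY by blast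
  qed
qed

text \<open>
  The number of triangles makes \<open>arcs_le_triangle_count\<close> an equality, and the possible sizes of the
  parts follow because \<open>C \<union> X \<union> Y\<close> without one vertex and \<open>Q\<close> have sizes that differ by at most one.
\<close>

lemma near_extremal_no_subinvariant:
  fixes g :: "'a \<Rightarrow> real"
  assumes G: "simple_graph V E"
    and g: "\<And>u. u \<in> V \<Longrightarrow> 0 \<le> g u" "\<exists>u\<in>V. g u \<noteq> 0"
    and sub: "\<And>u. u \<in> V \<Longrightarrow> \<mu> * g u \<le> (\<Sum>v\<in>E `` {u}. g v)"
    and mu: "0 < \<mu>" "real (card V * card V div 4) \<le> \<mu>\<^sup>2"
    and f: "3 \<le> card V div 2"
    and m: "card E = 2 * (card V * card V div 4 - 1)"
    and t: "card (triangle_sets E) = card V div 2 - 2"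
  shows False
proof -
  let ?n = "card V"
  define f where "f = ?n div 2"
  have f3: "3 \<le> f" using f by (simp add: f_def)
  have ne: "triangle_sets E \<noteq> {}" using t f by auto
  have six: "6 \<le> ?n" and large: "7 \<le> ?n \<or> card (triangle_sets E) = 1" using f t by linarith+
  have cases: "(?n = 2 * f \<and> ?n * ?n div 4 = f * f) \<or> (?n = 2 * f + 1 \<and> ?n * ?n div 4 = f * f + f)"
    unfolding f_def by (rule quarter_square_cases)
  have t': "card (triangle_sets E) = f - 2" using t by (simp add: f_def)
  obtain j where j: "f = j + 3" using f3 by (metis add.commute le_Suc_ex)
  have prev: "(?n - 1) * (?n - 1) div 4 + f = ?n * ?n div 4"
    unfolding f_def by (rule quarter_square_pred)
  have eq: "card E = 2 * ((?n - 1) * (?n - 1) div 4 + card (triangle_sets E) + 1)"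
    unfolding m prev[symmetric] t' by (simp add: j)
  obtain x y C X Y Q where D: "defective_bipartite V E x y C X Y Q"
    and C: "card C = card (triangle_sets E)"
    and sum: "card C + card X + card Y + card Q + 2 = ?n"
    and prod: "(card C + card X + card Y - 1) * card Q = (?n - 3) * (?n - 3) div 4"
    using near_extremal_structure[OF G ne six large eq] by metis
  define p where "p = card C + card X + card Y - 1"
  have p: "p + 1 = card C + card X + card Y" and pq: "p + card Q = ?n - 3"
    using C t' f3 j sum by (simp_all add: p_def)
  have "p * card Q = (p + card Q) * (p + card Q) div 4"
    using prod unfolding p_def[symmetric] pq .
  then have bal: "p = (p + card Q) div 2 \<or> card Q = (p + card Q) div 2"
    by (rule balanced_parts)
  have "card X + card Y = 2 \<and> card Q + 2 = f \<and> ?n * ?n div 4 = f * f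
      \<or> card X + card Y = 2 \<and> card Q + 1 = f \<and> ?n * ?n div 4 = f * f + f
      \<or> card X + card Y = 1 \<and> card Q + 1 = f \<and> ?n * ?n div 4 = f * f"
    using cases bal p pq C t' j by auto
  then show False
    using defective_bipartite_spectral_bound[OF G D g sub f3 _ mu(1,2)] C t' f3 by auto
qed

section \<open>The spectral radius and the Turan graph\<close>

text \<open>
  Take the moduli of an eigenvector for an eigenvalue of maximal modulus; the triangle inequality turns
  the eigenvalue equation into the stated inequality.
\<close>

lemma subinvariant_vector:
  assumes G: "pair_graph G" and ne: "pverts G \<noteq> {}"
  obtains g :: "'a \<Rightarrow> real" where "\<And>u. 0 \<le> g u" "\<exists>u\<in>pverts G. g u \<noteq> 0"
    "\<And>u. u \<in> pverts G \<Longrightarrow> graph_spectral_radius G * g u \<le> (\<Sum>v\<in>parcs G `` {u}. g v)"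
    "0 \<le> graph_spectral_radius G"
proof -
  interpret pair_graph G by fact
  obtain vs where vs: "distinct vs" "set vs = pverts G"
    using finite_distinct_list[OF finite_verts] by auto
  let ?A = "adjacency_matrix G vs"
  have A: "?A \<in> carrier_mat (length vs) (length vs)" by (simp add: adjacency_matrix_def)
  have "length vs \<noteq> 0" using vs ne by auto
  then have "spectral_radius ?A \<in> norm ` spectrum ?A"
    using spectral_radius_mem_max(1)[OF A] by simp
  then obtain k where k: "eigenvalue ?A k" "graph_spectral_radius G = norm k"
    using graph_spectral_radius_eq[OF vs] by (auto simp: spectrum_def)
  obtain f where f: "\<exists>u\<in>pverts G. f u \<noteq> 0"
    "\<And>u. u \<in> pverts G \<Longrightarrow> (\<Sum>v\<in>pverts G. if (u, v) \<in> parcs G then f v else 0) = k * f u"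
    using k(1) unfolding eigenvalue_adjacency_matrix_iff[OF vs] by blast
  show ?thesis
  proof (rule that[of "\<lambda>u. norm (f u)"])
    fix u assume u: "u \<in> pverts G"
    have N: "pverts G \<inter> {v. (u, v) \<in> parcs G} = parcs G `` {u}"
      using in_arcsD2 by auto
    have "k * f u = (\<Sum>v\<in>parcs G `` {u}. f v)"
      unfolding f(2)[OF u, symmetric] N[symmetric]
      by (simp add: sum.inter_restrict)
    then have "norm k * norm (f u) = norm (\<Sum>v\<in>parcs G `` {u}. f v)"
      by (metis norm_mult)
    then show "graph_spectral_radius G * norm (f u) \<le> (\<Sum>v\<in>parcs G `` {u}. norm (f v))"
      using k(2) by (simp add: norm_sum)
  qed (use f(1) k(2) in auto)
qed

lemma simple_graph_pair_graph:
  assumes "pair_graph G"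
  shows "simple_graph (pverts G) (parcs G)"
proof -
  interpret pair_graph G by fact
  show ?thesis
    unfolding simple_graph_def
  proof (intro conjI)
    show "parcs G \<subseteq> pverts G \<times> pverts G" using in_arcsD1 in_arcsD2 by auto
    show "sym (parcs G)" using arcs_symmetric by (auto simp: sym_def)
    show "irrefl (parcs G)" using no_loops' by (auto simp: irrefl_def)
  qed simp
qed

lemma triangles_eq_triangle_sets:
  assumes "pair_graph G"
  shows "triangles G = triangle_sets (parcs G)"
  using triangle_sets_subset[OF simple_graph_pair_graph[OF assms]]
  by (auto simp: triangles_def triangle_sets_def)

lemma isomorphic_turan_graph:
  assumes G: "pair_graph G" and n: "card (pverts G) = n"
    and V: "pverts G = A \<union> B" "A \<inter> B = {}" and E: "parcs G = A \<times> B \<union> B \<times> A"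
    and A: "card A = n div 2"
  shows "graph_isomorphic G (bipartite_turan_graph n)"
proof -
  interpret pair_graph G by fact
  have fin: "finite A" "finite B" using finite_verts V(1) by simp_all
  have B: "card B = n - n div 2"
    using n V fin A by (simp add: card_Un_disjoint)
  have sizes: "nat \<lfloor>real n / 2\<rfloor> = n div 2" "nat \<lceil>real n / 2\<rceil> = n - n div 2"
    by linarith+
  obtain a where a: "bij_betw a A {..<n div 2}"
    using finite_same_card_bij[OF fin(1), of "{..<n div 2}"] A by auto
  obtain b where b: "bij_betw b B {n div 2..<n}"
    using finite_same_card_bij[OF fin(2), of "{n div 2..<n}"] B by auto
  define f where "f u = (if u \<in> A then a u else b u)" for u
  have fA: "bij_betw f A {..<n div 2}" using a by (rule bij_betw_cong[THEN iffD1, rotated]) (simp add: f_def)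
  have fB: "bij_betw f B {n div 2..<n}"
    using b by (rule bij_betw_cong[THEN iffD1, rotated]) (use V in \<open>auto simp: f_def\<close>)
  have "bij_betw f (A \<union> B) ({..<n div 2} \<union> {n div 2..<n})"
    using fA fB by (rule bij_betw_combine) auto
  moreover have "{..<n div 2} \<union> {n div 2..<n} = {..<n}" by auto
  ultimately have bij: "bij_betw f (A \<union> B) {..<n}" by simp
  have img: "f ` A = {..<n div 2}" "f ` B = {n div 2..<n}"
    using fA fB by (simp_all add: bij_betw_def)
  have "map_prod f f ` parcs G = {..<n div 2} \<times> {n div 2..<n} \<union> {n div 2..<n} \<times> {..<n div 2}"
    unfolding E image_Un map_prod_surj_on[OF img(1,2)] map_prod_surj_on[OF img(2,1)] ..
  moreover have "n div 2 + (n - n div 2) = n" by simp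
  ultimately show ?thesis
    using bij unfolding graph_isomorphic_iff[OF pair_wf_digraph_axioms]
    by (intro exI[of _ f]) (simp add: bipartite_turan_graph_def complete_bipartite_graph_def sizes V)
qed

theorem theorem7:
  fixes G :: "'a pair_pre_digraph" and n :: nat
  assumes "pair_graph G"
    and "card (pverts G) = n"
    and "graph_spectral_radius G \<ge> sqrt (of_int \<lfloor>(real n)\<^sup>2 / 4\<rfloor>)"
    and "\<not> graph_isomorphic G (bipartite_turan_graph n)"
  shows "int (triangle_count G) \<ge> \<lfloor>real n / 2\<rfloor> - 1"
proof -
  define V where "V = pverts G"
  define E where "E = parcs G"
  define f where "f = n div 2"
  define q where "q = n * n div 4"
  define t where "t = card (triangle_sets E)"
  have G: "simple_graph V E" unfolding V_def E_def by (rule simple_graph_pair_graph[OF assms(1)])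
  have n: "card V = n" using assms(2) by (simp add: V_def)
  have count: "triangle_count G = t"
    by (simp add: triangle_count_def t_def E_def triangles_eq_triangle_sets[OF assms(1)])
  have floor: "\<lfloor>real n / 2\<rfloor> = int f" unfolding f_def by linarith
  have qf: "(n = 2 * f \<and> q = f * f) \<or> (n = 2 * f + 1 \<and> q = f * f + f)"
    unfolding f_def q_def by (rule quarter_square_cases)
  have "f \<le> t + 1"
  proof (cases "f \<le> 1")
    case False
    then have f2: "2 \<le> f" by simp
    have "V \<noteq> {}" using n f2 by (auto simp: f_def)
    then obtain g :: "'a \<Rightarrow> real" where g: "\<And>u. 0 \<le> g u" "\<exists>u\<in>V. g u \<noteq> 0"
      and sub: "\<And>u. u \<in> V \<Longrightarrow> graph_spectral_radius G * g u \<le> (\<Sum>v\<in>E `` {u}. g v)"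
      and mu0: "0 \<le> graph_spectral_radius G"
      using subinvariant_vector[OF assms(1)] unfolding V_def E_def by metis
    define \<mu> where "\<mu> = graph_spectral_radius G"
    have mu: "sqrt (real q) \<le> \<mu>"
      using assms(3) by (simp add: \<mu>_def floor_quarter_square q_def)
    then have muq: "real q \<le> \<mu>\<^sup>2" using sqrt_le_D by blast
    have fq: "f * f \<le> q" "4 \<le> f * f" using qf mult_le_mono[OF f2 f2] by auto
    then have "0 < sqrt (real q)" by (intro real_sqrt_gt_zero) linarith
    then have mupos: "0 < \<mu>" using mu by linarith
    obtain \<rho> where rho: "\<mu> \<le> \<rho>" "\<rho>\<^sup>2 \<le> real (card E)"
      "\<rho> ^ 3 \<le> 6 * real t + (real (card E) - \<rho>\<^sup>2) * sqrt (real (card E) - \<rho>\<^sup>2)"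
      using spectral_triangle_inequality[OF G _ g(2) sub mu0] g(1) unfolding \<mu>_def t_def by metis
    have rho0: "0 \<le> \<rho>" using rho(1) mupos by simp
    have rhoq: "real q \<le> \<rho>\<^sup>2" using muq rho(1) mupos by (meson less_imp_le order_trans power_mono)
    obtain m where m: "card E = 2 * m" using even_card_arcs[OF G] by auto
    have lower: "m + f \<le> q + t + 1" if "triangle_sets E \<noteq> {}"
    proof -
      have "(n - 1) * (n - 1) div 4 + f = q"
        unfolding q_def f_def by (rule quarter_square_pred)
      then show ?thesis
        using arcs_le_triangle_count[OF G that] m by (simp add: n t_def)
    qed
    \<comment> \<open>The number \<open>m\<close> of edges decides between the spectral and the combinatorial bound.\<close>
    consider "m + 2 \<le> q" | "m + 1 = q" | "q \<le> m" "triangle_sets E \<noteq> {}" | "q \<le> m" "triangle_sets E = {}"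
      by linarith
    then show ?thesis
    proof cases
      case 1
      have "real f \<le> \<rho>"
      proof (rule power2_le_imp_le[OF _ rho0])
        have "real (f * f) \<le> real q" using fq(1) by (rule of_nat_mono)
        then show "(real f)\<^sup>2 \<le> \<rho>\<^sup>2" using rhoq by (simp add: power2_eq_square)
      qed
      moreover have "4 \<le> 2 * \<rho>\<^sup>2 - real (card E)" using 1 m rhoq by simp
      ultimately have "real f - 1 \<le> real t"
        using triangle_count_ge_of_spectral_gap[OF rho0 rho(2,3)] f2 by blast
      then show ?thesis by linarith
    next
      case 2
      have "0 < real t"
        by (rule triangle_count_positive[OF rho0 rho(2,3)]) (use 2 m rhoq in simp)
      then have t0: "triangle_sets E \<noteq> {}" "0 < t" by (auto simp: t_def)
      show ?thesis
      proof (rule ccontr)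
        assume "\<not> f \<le> t + 1"
        then have "t = f - 2" "3 \<le> f" using lower[OF t0(1)] 2 t0(2) by linarith+
        moreover have "card E = 2 * (q - 1)" using 2 m by simp
        ultimately show False
          using near_extremal_no_subinvariant[OF G _ g(2) sub[folded \<mu>_def] mupos] g(1) muq
          by (auto simp: n q_def f_def t_def)
      qed
    next
      case 3
      then show ?thesis using lower by linarith
    next
      case 4
      have "card E \<le> 2 * q" using mantel[OF G 4(2)] by (simp add: n q_def)
      then have "card E = 2 * (card V * card V div 4)" using 4(1) m by (simp add: n q_def)
      then obtain A B where AB: "V = A \<union> B" "A \<inter> B = {}" "E = A \<times> B \<union> B \<times> A"
        "card V = card A + card B" "card A * card B = card V * card V div 4"
        using mantel_extremal[OF G 4(2)] by metis
      have "card A = (card A + card B) div 2 \<or> card B = (card A + card B) div 2"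
        by (rule balanced_parts) (use AB(4,5) in simp)
      then have "graph_isomorphic G (bipartite_turan_graph n)"
      proof
        assume "card A = (card A + card B) div 2"
        then show ?thesis
          using isomorphic_turan_graph[OF assms(1,2), of A B] AB n by (simp add: V_def E_def)
      next
        assume "card B = (card A + card B) div 2"
        moreover have "V = B \<union> A" "B \<inter> A = {}" "E = B \<times> A \<union> A \<times> B" using AB(1-3) by auto
        ultimately show ?thesis
          using isomorphic_turan_graph[OF assms(1,2), of B A] AB(4) n by (simp add: V_def E_def)
      qed
      then show ?thesis using assms(4) by blast
    qed
  qed simp
  then show ?thesis using count floor by simp
qed

end
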